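(* Let $G$ be a finite abelian group that is not an elementary abelian $2$-group, let $\mathbf{k}$ be a field with $\operatorname{char}\mathbf{k}\nmid|G|$, and let $V$ be a faithful finite-dimensional representation of $G$ over $\mathbf{k}$. Then $$\gamma^{\mathbf{r}}_{\mathrm{field}}(G,V)\geq 3.$$
   Context: The trivial group counts as an elementary abelian $2$-group (of rank $0$). $\mathbf{k}[V]$ is the polynomial ring of $V$ (the symmetric algebra of $V^*$, with its induced $G$-action), $\mathbf{k}(V)$ is its fraction field, and $\mathbf{k}(V)^G$ is the field of invariant rational functions. For $f\in\mathbf{k}(V)$ written as $f=f_1/f_2$ with $f_1,f_2\in\mathbf{k}[V]$ and $\gcd(f_1,f_2)=1$, the degree of $f$ is $\deg f:=\deg f_1+\deg f_2$ (constants, including $0$, have degree $0$). $\mathbf{k}(V)^G_{\leq d}$ is the set of invariant rational functions of degree $\leq d$. Define $$\gamma^{\mathbf{r}}_{\mathrm{field}}(G,V):=\min\{d:\mathbf{k}(V)^G_{\leq d}\text{ contains a transcendence basis for }\mathbf{k}(V)^G\text{ over }\mathbf{k}\},$$ the minimum being over positive integers $d$. *)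

theory Defs
  imports
    "HOL-Algebra.Coset"
    "HOL-Library.Poly_Mapping"
    "HOL-Computational_Algebra.Polynomial"
    "HOL-Computational_Algebra.Fraction_Field"
begin

section \<open>Representations\<close>

definition elementary_abelian :: "nat \<Rightarrow> ('g, 'm) monoid_scheme \<Rightarrow> bool" where
  "elementary_abelian p G \<longleftrightarrow>
     comm_group G \<and> (\<forall>x\<in>carrier G. x [^]\<^bsub>G\<^esub> p = \<one>\<^bsub>G\<^esub>)"

text \<open>The vector space \<open>V\<close> is the whole type \<open>'v\<close>, with scalar multiplication \<open>scale\<close>.\<close>

locale group_representation = group G + vector_space scale
  for G :: "('g, 'm) monoid_scheme" (structure)
    and scale :: "'k::field \<Rightarrow> 'v::ab_group_add \<Rightarrow> 'v" +
  fixes \<rho> :: "'g \<Rightarrow> 'v \<Rightarrow> 'v"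
  assumes linear_rho: "g \<in> carrier G \<Longrightarrow> Vector_Spaces.linear scale scale (\<rho> g)"
    and rho_one: "\<rho> \<one> = id"
    and rho_mult: "g \<in> carrier G \<Longrightarrow> h \<in> carrier G \<Longrightarrow> \<rho> (g \<otimes> h) = \<rho> g \<circ> \<rho> h"

locale faithful_representation = group_representation +
  assumes faithful: "inj_on \<rho> (carrier G)"

text \<open>A basis of \<open>V\<close> indexed by a finite type; its existence says that \<open>V\<close> has finite
  dimension \<open>CARD('n)\<close>. The dimension is then positive, which excludes no nontrivial group
  acting faithfully.\<close>

definition (in vector_space) indexed_basis :: "('n::finite \<Rightarrow> 'b) \<Rightarrow> bool" where
  "indexed_basis b \<longleftrightarrow> inj b \<and> independent (Set.range b) \<and> span (Set.range b) = UNIV"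


section \<open>Polynomials and rational functions\<close>

type_synonym ('n, 'k) mpoly = "('n \<Rightarrow>\<^sub>0 nat) \<Rightarrow>\<^sub>0 'k"

text \<open>After the choice of a basis \<open>b\<close> of \<open>V\<close> indexed by \<open>'n\<close>, the symmetric algebra of the dual
  space is the polynomial ring in the coordinate functions dual to \<open>b\<close>. The order on the
  index type is only there because the library needs it to show that this ring is an
  integral domain.\<close>

type_synonym ('n, 'k) ratfun = "('n, 'k) mpoly fract"

definition mconst :: "'k::zero \<Rightarrow> ('n, 'k) mpoly" where
  "mconst c = Poly_Mapping.single 0 c"

definition mvar :: "'n \<Rightarrow> ('n, 'k::zero_neq_one) mpoly" where
  "mvar i = Poly_Mapping.single (Poly_Mapping.single i 1) 1"

text \<open>Substitution of \<open>x i\<close> for the \<open>i\<close>-th variable, with coefficients mapped along \<open>\<phi>\<close>.\<close>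

definition msubst ::
  "('k::zero \<Rightarrow> 'r::comm_ring_1) \<Rightarrow> ('i \<Rightarrow> 'r) \<Rightarrow> ('i, 'k) mpoly \<Rightarrow> 'r" where
  "msubst \<phi> x p =
     (\<Sum>m\<in>Poly_Mapping.keys p. \<phi> (Poly_Mapping.lookup p m) *
        (\<Prod>i\<in>Poly_Mapping.keys m. x i ^ Poly_Mapping.lookup m i))"

definition total_degree :: "('n, 'k::zero) mpoly \<Rightarrow> nat" where
  "total_degree p =
     Max (insert 0 ((\<lambda>m. \<Sum>i\<in>Poly_Mapping.keys m. Poly_Mapping.lookup m i) ` Poly_Mapping.keys p))"

definition rconst :: "'k::field \<Rightarrow> ('n::{finite,linorder}, 'k) ratfun" where
  "rconst c = Fract (mconst c) 1"

text \<open>The library's \<^const>\<open>coprime\<close> asks for a type class that polynomials of this type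
  do not instantiate; the condition on \<open>h\<close> below is its definition.\<close>

definition reduced_fraction ::
  "('n::{finite,linorder}, 'k::field) mpoly \<Rightarrow> ('n, 'k) mpoly \<Rightarrow> ('n, 'k) ratfun \<Rightarrow> bool" where
  "reduced_fraction p q f \<longleftrightarrow>
     q \<noteq> 0 \<and> f = Fract p q \<and> (\<forall>h. h dvd p \<longrightarrow> h dvd q \<longrightarrow> h dvd 1)"

text \<open>Reduced fractions are unique up to a common nonzero constant factor, so the value does
  not depend on the choice.\<close>

definition rat_degree :: "('n::{finite,linorder}, 'k::field) ratfun \<Rightarrow> nat" where
  "rat_degree f =
     (SOME d. \<exists>p q. reduced_fraction p q f \<and> d = total_degree p + total_degree q)"


section \<open>Transcendence bases\<close>

definition is_subfield :: "'a::field set \<Rightarrow> bool" where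
  "is_subfield L \<longleftrightarrow> 0 \<in> L \<and> 1 \<in> L \<and>
     (\<forall>x\<in>L. \<forall>y\<in>L. x + y \<in> L \<and> x * y \<in> L) \<and> (\<forall>x\<in>L. - x \<in> L \<and> inverse x \<in> L)"

definition subfield_generated :: "'a::field set \<Rightarrow> 'a set" where
  "subfield_generated S = \<Inter>{L. is_subfield L \<and> S \<subseteq> L}"

definition algebraic_over :: "'a::field set \<Rightarrow> 'a \<Rightarrow> bool" where
  "algebraic_over L a \<longleftrightarrow> (\<exists>q. q \<noteq> 0 \<and> (\<forall>i. coeff q i \<in> L) \<and> poly q a = 0)"

text \<open>The base field \<open>'k\<close> is embedded in \<open>'a\<close> by \<open>\<phi>\<close>. The elements of \<open>B\<close> index the variables
  of the polynomials that witness a possible dependence.\<close>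

definition algebraically_independent :: "('k::field \<Rightarrow> 'a::field) \<Rightarrow> 'a set \<Rightarrow> bool" where
  "algebraically_independent \<phi> B \<longleftrightarrow>
     (\<forall>P :: ('a, 'k) mpoly. (\<forall>m\<in>Poly_Mapping.keys P. Poly_Mapping.keys m \<subseteq> B) \<longrightarrow>
        msubst \<phi> (\<lambda>a. a) P = 0 \<longrightarrow> P = 0)"

definition transcendence_basis ::
  "('k::field \<Rightarrow> 'a::field) \<Rightarrow> 'a set \<Rightarrow> 'a set \<Rightarrow> bool" where
  "transcendence_basis \<phi> F B \<longleftrightarrow>
     B \<subseteq> F \<and> algebraically_independent \<phi> B \<and>
     (\<forall>f\<in>F. algebraic_over (subfield_generated (Set.range \<phi> \<union> B)) f)"


section \<open>Invariant rational functions\<close>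

text \<open>\<open>g\<close> sends a function \<open>f\<close> on \<open>V\<close> to \<open>f \<circ> \<rho>(g\<inverse>)\<close>. Hence it sends the \<open>i\<close>-th coordinate
  function to the linear form whose value at \<open>b j\<close> is the \<open>i\<close>-th coordinate of
  \<open>\<rho>(g\<inverse>)(b j)\<close>.\<close>

definition poly_action ::
  "('g, 'm) monoid_scheme \<Rightarrow> ('k::field \<Rightarrow> 'v::ab_group_add \<Rightarrow> 'v) \<Rightarrow> ('g \<Rightarrow> 'v \<Rightarrow> 'v) \<Rightarrow>
     ('n::{finite,linorder} \<Rightarrow> 'v) \<Rightarrow> 'g \<Rightarrow> ('n, 'k) mpoly \<Rightarrow> ('n, 'k) mpoly" where
  "poly_action G scale \<rho> b g =
     msubst mconst
       (\<lambda>i. \<Sum>j\<in>UNIV.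
          mconst (module.representation scale (Set.range b) (\<rho> (inv\<^bsub>G\<^esub> g) (b j)) (b i)) * mvar j)"

text \<open>The action on polynomials is by ring automorphisms, so the value below does not depend on
  the fraction representing \<open>f\<close>.\<close>

definition rat_action ::
  "('g, 'm) monoid_scheme \<Rightarrow> ('k::field \<Rightarrow> 'v::ab_group_add \<Rightarrow> 'v) \<Rightarrow> ('g \<Rightarrow> 'v \<Rightarrow> 'v) \<Rightarrow>
     ('n::{finite,linorder} \<Rightarrow> 'v) \<Rightarrow> 'g \<Rightarrow> ('n, 'k) ratfun \<Rightarrow> ('n, 'k) ratfun" where
  "rat_action G scale \<rho> b g f =
     (THE r. \<exists>p q. q \<noteq> 0 \<and> f = Fract p q \<and>
        r = Fract (poly_action G scale \<rho> b g p) (poly_action G scale \<rho> b g q))"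

definition invariant_field ::
  "('g, 'm) monoid_scheme \<Rightarrow> ('k::field \<Rightarrow> 'v::ab_group_add \<Rightarrow> 'v) \<Rightarrow> ('g \<Rightarrow> 'v \<Rightarrow> 'v) \<Rightarrow>
     ('n::{finite,linorder} \<Rightarrow> 'v) \<Rightarrow> ('n, 'k) ratfun set" where
  "invariant_field G scale \<rho> b = {f. \<forall>g\<in>carrier G. rat_action G scale \<rho> b g f = f}"

definition gamma_r_field ::
  "('g, 'm) monoid_scheme \<Rightarrow> ('k::field \<Rightarrow> 'v::ab_group_add \<Rightarrow> 'v) \<Rightarrow> ('g \<Rightarrow> 'v \<Rightarrow> 'v) \<Rightarrow>
     ('n::{finite,linorder} \<Rightarrow> 'v) \<Rightarrow> nat" where
  "gamma_r_field G scale \<rho> b =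
     (LEAST d. d > 0 \<and>
        (\<exists>B. B \<subseteq> {f \<in> invariant_field G scale \<rho> b. rat_degree f \<le> d} \<and>
             transcendence_basis rconst (invariant_field G scale \<rho> b) B))"

end

theory Submission
  imports Defs "HOL-Computational_Algebra.Formal_Power_Series"
begin

text \<open>The field of invariants of degree at most two has hidden continuous symmetries. For
  \<open>g \<in> G\<close>, let \<open>M\<close> be its action on the coordinates. The linear maps
  \<open>h\<^sub>t = ((1 - t) + t M) ((1 - t) + t M\<inverse>)\<inverse>\<close>, with \<open>t\<close> a formal parameter, form a one-parameter
  family that starts at the identity. Once scalars are extended so that \<open>G\<close> acts diagonally, \<open>h\<^sub>t\<close>
  acts on the weight spaces of a character and of its inverse by mutually inverse scalars. Hence
  \<open>h\<^sub>t\<close> fixes invariant polynomials of degree at most two, and quotients of two affine polynomials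
  of the same weight. Up to inverses, these are all the rational invariants of degree at most two.
  In terms of the formula for \<open>h\<^sub>t\<close>, the same fact becomes an identity over the given field, which
  is how it is proved below (\<open>degree_2_invariants_agree\<close>).

  Substituting \<open>h\<^sub>t x\<close> for the coordinates \<open>x\<close> gives a homomorphism from \<open>K = \<^bold>k(V)\<close> to the
  power series ring \<open>K[[t]]\<close> that is the identity modulo \<open>t\<close>. The elements of \<open>K\<close> with constant image
  form a subfield which is algebraically closed in \<open>K\<close>, because a power series that is algebraic
  over \<open>K\<close> is constant (\<open>root_in_fps_is_constant\<close>). If invariants of degree at most two contained
  a transcendence basis, this subfield would contain all invariants, therefore also the coordinates,
  which are algebraic over the invariants of a finite group. But the coefficient of \<open>t\<close> in \<open>h\<^sub>t x\<close>
  is \<open>M x - M\<inverse> x\<close>, so then \<open>M = M\<inverse>\<close>, and faithfulness gives \<open>g\<^sup>2 = 1\<close>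
  (\<open>square_eq_one_if_degree_2_basis\<close>). Some \<open>g\<close> violates this unless \<open>G\<close> is an elementary abelian
  2-group.

  Since \<^const>\<open>gamma_r_field\<close> is a least element, the set of admissible degrees also has to be
  nonempty. This holds as the invariants have a finite transcendence basis: by counting monomials,
  more than \<open>dim V\<close> rational functions are dependent (\<open>algebraically_dependent_if_card_gt\<close>), so
  that independent sets of maximal size exist.\<close>


section \<open>Evaluation of polynomials\<close>

locale unital_hom =
  fixes f :: "'a::comm_ring_1 \<Rightarrow> 'b::comm_ring_1"
  assumes one: "f 1 = 1"
    and add: "f (x + y) = f x + f y"
    and mult: "f (x * y) = f x * f y"
begin

lemma zero: "f 0 = 0"
  using add[of 0 0] by simp

lemma uminus: "f (- x) = - f x"
  using add[of x "- x"] zero by (simp add: eq_neg_iff_add_eq_0 add.commute)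

lemma sum: "f (sum h A) = (\<Sum>a\<in>A. f (h a))"
  by (induction A rule: infinite_finite_induct) (simp_all add: zero add)

lemma prod: "f (prod h A) = (\<Prod>a\<in>A. f (h a))"
  by (induction A rule: infinite_finite_induct) (simp_all add: one mult)

lemma power: "f (x ^ n) = f x ^ n"
  by (induction n) (simp_all add: one mult)

end

lemma unital_hom_compose:
  assumes "unital_hom f" "unital_hom h"
  shows "unital_hom (\<lambda>x. h (f x))"
proof -
  interpret f: unital_hom f by fact
  interpret h: unital_hom h by fact
  show ?thesis by unfold_locales (simp_all add: f.one h.one f.add h.add f.mult h.mult)
qed

lemma unital_hom_mconst: "unital_hom (mconst :: 'k::comm_ring_1 \<Rightarrow> ('n, 'k) mpoly)"
  by unfold_locales (simp_all add: mconst_def single_add mult_single)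

lemma unital_hom_to_fract: "unital_hom (\<lambda>p. Fract p 1)"
  by unfold_locales (simp_all add: One_fract_def)

lemma unital_hom_rconst: "unital_hom (rconst :: 'k::field \<Rightarrow> ('n::{finite,linorder}, 'k) ratfun)"
  unfolding rconst_def by (rule unital_hom_compose[OF unital_hom_mconst unital_hom_to_fract])

lemma unital_hom_fps_const: "unital_hom (fps_const :: 'a::comm_ring_1 \<Rightarrow> 'a fps)"
  by unfold_locales simp_all

definition monom_value :: "('i \<Rightarrow> 'r::comm_ring_1) \<Rightarrow> ('i \<Rightarrow>\<^sub>0 nat) \<Rightarrow> 'r" where
  "monom_value x m = (\<Prod>i\<in>Poly_Mapping.keys m. x i ^ Poly_Mapping.lookup m i)"

lemma monom_value_superset:
  assumes "finite A" "Poly_Mapping.keys m \<subseteq> A"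
  shows "monom_value x m = (\<Prod>i\<in>A. x i ^ Poly_Mapping.lookup m i)"
  unfolding monom_value_def
  by (rule prod.mono_neutral_left) (use assms in \<open>auto simp: in_keys_iff\<close>)

lemma monom_value_zero [simp]: "monom_value x 0 = 1"
  by (simp add: monom_value_def)

lemma monom_value_add: "monom_value x (m + m') = monom_value x m * monom_value x m'"
proof -
  let ?A = "Poly_Mapping.keys m \<union> Poly_Mapping.keys m'"
  have "Poly_Mapping.keys (m + m') \<subseteq> ?A" by (rule Poly_Mapping.keys_add)
  then have "monom_value x (m + m') = (\<Prod>i\<in>?A. x i ^ Poly_Mapping.lookup (m + m') i)"
    by (intro monom_value_superset) auto
  also have "\<dots> = (\<Prod>i\<in>?A. x i ^ Poly_Mapping.lookup m i) * (\<Prod>i\<in>?A. x i ^ Poly_Mapping.lookup m' i)"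
    by (simp add: lookup_add power_add prod.distrib)
  also have "\<dots> = monom_value x m * monom_value x m'"
    by (simp add: monom_value_superset[of ?A])
  finally show ?thesis .
qed

lemma monom_value_single: "monom_value x (Poly_Mapping.single i n) = x i ^ n"
  by (subst monom_value_superset[of "{i}"]) auto

lemma monom_value_hom:
  assumes "unital_hom f"
  shows "f (monom_value x m) = monom_value (\<lambda>i. f (x i)) m"
  using assms by (simp add: monom_value_def unital_hom.prod unital_hom.power)

lemma sum_of_monomials:
  "p = (\<Sum>m\<in>Poly_Mapping.keys p. Poly_Mapping.single m (Poly_Mapping.lookup p m))"
  by (rule poly_mapping_eqI)
    (auto simp: lookup_sum lookup_single when_def sum.delta in_keys_iff)

lemma msubst_alt:
  "msubst \<phi> x p = (\<Sum>m\<in>Poly_Mapping.keys p. \<phi> (Poly_Mapping.lookup p m) * monom_value x m)"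
  by (simp add: msubst_def monom_value_def)

lemma msubst_superset:
  assumes "\<phi> 0 = 0" "finite A" "Poly_Mapping.keys p \<subseteq> A"
  shows "msubst \<phi> x p = (\<Sum>m\<in>A. \<phi> (Poly_Mapping.lookup p m) * monom_value x m)"
  unfolding msubst_alt
  by (rule sum.mono_neutral_left) (use assms in \<open>auto simp: in_keys_iff\<close>)

lemma msubst_single:
  assumes "\<phi> 0 = 0"
  shows "msubst \<phi> x (Poly_Mapping.single m c) = \<phi> c * monom_value x m"
  by (subst msubst_superset[of _ "{m}"]) (use assms in auto)

lemma msubst_mconst:
  assumes "\<phi> 0 = 0"
  shows "msubst \<phi> x (mconst c) = \<phi> c"
  by (simp add: mconst_def msubst_single assms)

lemma msubst_mvar:
  assumes "\<phi> 0 = 0" "\<phi> 1 = 1"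
  shows "msubst \<phi> x (mvar i) = x i"
  by (simp add: mvar_def msubst_single monom_value_single assms)

lemma msubst_add:
  fixes \<phi> :: "'k::comm_ring_1 \<Rightarrow> 'r::comm_ring_1"
  assumes "unital_hom \<phi>"
  shows "msubst \<phi> x (p + q) = msubst \<phi> x p + msubst \<phi> x q"
proof -
  interpret unital_hom \<phi> by fact
  let ?A = "Poly_Mapping.keys p \<union> Poly_Mapping.keys q"
  have "Poly_Mapping.keys (p + q) \<subseteq> ?A" by (rule Poly_Mapping.keys_add)
  then have "msubst \<phi> x (p + q) = (\<Sum>m\<in>?A. \<phi> (Poly_Mapping.lookup (p + q) m) * monom_value x m)"
    by (intro msubst_superset) (auto simp: zero)
  also have "\<dots> = (\<Sum>m\<in>?A. \<phi> (Poly_Mapping.lookup p m) * monom_value x m)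
      + (\<Sum>m\<in>?A. \<phi> (Poly_Mapping.lookup q m) * monom_value x m)"
    by (simp add: lookup_add add distrib_right sum.distrib)
  also have "\<dots> = msubst \<phi> x p + msubst \<phi> x q"
    by (simp add: msubst_superset[of _ ?A] zero)
  finally show ?thesis .
qed

lemma msubst_zero: "msubst \<phi> x 0 = 0"
  by (simp add: msubst_alt)

lemma msubst_sum:
  fixes \<phi> :: "'k::comm_ring_1 \<Rightarrow> 'r::comm_ring_1"
  assumes "unital_hom \<phi>"
  shows "msubst \<phi> x (sum h A) = (\<Sum>a\<in>A. msubst \<phi> x (h a))"
  by (induction A rule: infinite_finite_induct) (simp_all add: msubst_add[OF assms] msubst_zero)

lemma unital_hom_msubst:
  fixes \<phi> :: "'k::comm_ring_1 \<Rightarrow> 'r::comm_ring_1"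
  assumes "unital_hom \<phi>"
  shows "unital_hom (msubst \<phi> x)"
proof
  interpret unital_hom \<phi> by fact
  show "msubst \<phi> x 1 = 1"
    using msubst_single[of \<phi> x 0 1] by (simp add: zero one)
  fix p q :: "('a, 'k) mpoly"
  show "msubst \<phi> x (p + q) = msubst \<phi> x p + msubst \<phi> x q"
    by (rule msubst_add[OF assms])
  have "p * q = (\<Sum>m\<in>Poly_Mapping.keys p. \<Sum>m'\<in>Poly_Mapping.keys q.
      Poly_Mapping.single (m + m') (Poly_Mapping.lookup p m * Poly_Mapping.lookup q m'))"
    by (subst sum_of_monomials[of p], subst sum_of_monomials[of q])
      (simp add: sum_product mult_single)
  then have "msubst \<phi> x (p * q) = (\<Sum>m\<in>Poly_Mapping.keys p. \<Sum>m'\<in>Poly_Mapping.keys q.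
      \<phi> (Poly_Mapping.lookup p m * Poly_Mapping.lookup q m') * monom_value x (m + m'))"
    by (simp add: msubst_sum[OF assms] msubst_single zero)
  also have "\<dots> = msubst \<phi> x p * msubst \<phi> x q"
    by (simp add: msubst_alt sum_product monom_value_add mult algebra_simps)
  finally show "msubst \<phi> x (p * q) = msubst \<phi> x p * msubst \<phi> x q" .
qed

lemma single_eq_monom_value:
  fixes m :: "'n \<Rightarrow>\<^sub>0 nat" and c :: "'k::comm_ring_1"
  shows "Poly_Mapping.single m c = mconst c * monom_value mvar m"
proof -
  have pow: "mvar i ^ n = Poly_Mapping.single (Poly_Mapping.single i n) (1 :: 'k)" for i :: 'n and n
    by (induction n) (simp_all add: mvar_def mult_single single_add[symmetric])
  have "monom_value mvar m = Poly_Mapping.single (\<Sum>i\<in>A. Poly_Mapping.single i (Poly_Mapping.lookup m i)) (1::'k)"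
    if "A = Poly_Mapping.keys m" for A
  proof -
    have "finite A" using that by simp
    then have "(\<Prod>i\<in>A. mvar i ^ Poly_Mapping.lookup m i) =
        Poly_Mapping.single (\<Sum>i\<in>A. Poly_Mapping.single i (Poly_Mapping.lookup m i)) (1::'k)"
      by (induction A rule: finite_induct) (simp_all add: pow mult_single)
    then show ?thesis using that by (simp add: monom_value_def)
  qed
  then show ?thesis
    using sum_of_monomials[of m] by (simp add: mconst_def mult_single)
qed

text \<open>A ring homomorphism out of a polynomial ring is the evaluation at the images of the
  variables; this is how identities between compositions of substitutions are checked.\<close>

lemma unital_hom_eq_msubst:
  fixes F :: "('n, 'k::comm_ring_1) mpoly \<Rightarrow> 'r::comm_ring_1"
  assumes "unital_hom F"
  shows "F p = msubst (\<lambda>c. F (mconst c)) (\<lambda>i. F (mvar i)) p"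
proof -
  interpret unital_hom F by fact
  have "F p = (\<Sum>m\<in>Poly_Mapping.keys p. F (Poly_Mapping.single m (Poly_Mapping.lookup p m)))"
    using sum_of_monomials[of p] sum by metis
  also have "\<dots> = msubst (\<lambda>c. F (mconst c)) (\<lambda>i. F (mvar i)) p"
    by (simp add: msubst_alt single_eq_monom_value mult monom_value_hom[OF assms])
  finally show ?thesis .
qed

lemma msubst_msubst:
  fixes \<phi> :: "'k::comm_ring_1 \<Rightarrow> 'r::comm_ring_1" and w :: "'i \<Rightarrow> ('j, 'k) mpoly"
  assumes "unital_hom \<phi>"
  shows "msubst \<phi> v (msubst mconst w p) = msubst \<phi> (\<lambda>i. msubst \<phi> v (w i)) p"
proof -
  interpret unital_hom \<phi> by fact
  interpret c: unital_hom "mconst :: 'k \<Rightarrow> ('j, 'k) mpoly" by (rule unital_hom_mconst)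
  show ?thesis
    by (subst unital_hom_eq_msubst[OF unital_hom_compose[OF unital_hom_msubst[OF unital_hom_mconst]
          unital_hom_msubst[OF assms]]])
      (simp add: msubst_mconst msubst_mvar zero one c.zero c.one)
qed

lemma hom_msubst:
  fixes \<phi> :: "'k::comm_ring_1 \<Rightarrow> 'r::comm_ring_1" and h :: "'r \<Rightarrow> 's::comm_ring_1"
  assumes "unital_hom h"
  shows "h (msubst \<phi> v p) = msubst (\<lambda>c. h (\<phi> c)) (\<lambda>i. h (v i)) p"
  using assms by (simp add: msubst_alt unital_hom.sum unital_hom.mult monom_value_hom)

lemma msubst_mconst_mvar: "msubst mconst mvar p = p"
  using unital_hom_eq_msubst[of "\<lambda>p. p" p] by (simp add: unital_hom_def)


section \<open>Degree and reduced fractions\<close>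

definition monom_degree :: "('n \<Rightarrow>\<^sub>0 nat) \<Rightarrow> nat" where
  "monom_degree m = (\<Sum>i\<in>Poly_Mapping.keys m. Poly_Mapping.lookup m i)"

text \<open>Substituting \<open>x\<^sub>i T\<close> for \<open>x\<^sub>i\<close> turns the total degree into the degree in the single variable
  \<open>T\<close>, which is known to be additive over an integral domain.\<close>

definition homogenize :: "('n, 'k::comm_ring_1) mpoly \<Rightarrow> ('n, 'k) mpoly poly" where
  "homogenize = msubst (\<lambda>c. [:mconst c:]) (\<lambda>i. monom (mvar i) 1)"

lemma unital_hom_const_poly: "unital_hom (\<lambda>c::'a::comm_ring_1. [:c:])"
  by unfold_locales (simp_all add: one_pCons)

lemma unital_hom_homogenize: "unital_hom homogenize"
  unfolding homogenize_def
  by (intro unital_hom_msubst unital_hom_compose[OF unital_hom_mconst unital_hom_const_poly])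

lemma homogenize_single:
  fixes m :: "'n \<Rightarrow>\<^sub>0 nat" and c :: "'k::comm_ring_1"
  shows "homogenize (Poly_Mapping.single m c) = monom (Poly_Mapping.single m c) (monom_degree m)"
proof -
  have "(\<Prod>i\<in>A. monom (mvar i :: ('n, 'k) mpoly) 1 ^ Poly_Mapping.lookup m i) =
      monom (\<Prod>i\<in>A. mvar i ^ Poly_Mapping.lookup m i) (\<Sum>i\<in>A. Poly_Mapping.lookup m i)"
    if "finite A" for A :: "'n set"
    using that
    by (induction A rule: finite_induct)
      (simp_all add: monom_power mult_monom one_pCons monom_0)
  then have "monom_value (\<lambda>i. monom (mvar i :: ('n, 'k) mpoly) 1) m = monom (monom_value mvar m) (monom_degree m)"
    by (simp add: monom_value_def monom_degree_def)
  moreover have "homogenize (Poly_Mapping.single m c) =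
      [:mconst c:] * monom_value (\<lambda>i. monom (mvar i) 1) m"
    unfolding homogenize_def by (rule msubst_single) (simp add: mconst_def)
  ultimately show ?thesis
    by (simp add: smult_monom single_eq_monom_value[of m c])
qed

lemma lookup_coeff_homogenize:
  "Poly_Mapping.lookup (coeff (homogenize p) d) m = (if monom_degree m = d then Poly_Mapping.lookup p m else 0)"
proof -
  have "homogenize p =
      (\<Sum>m\<in>Poly_Mapping.keys p. monom (Poly_Mapping.single m (Poly_Mapping.lookup p m)) (monom_degree m))"
    by (subst sum_of_monomials[of p])
      (simp add: unital_hom.sum[OF unital_hom_homogenize] homogenize_single)
  then have "Poly_Mapping.lookup (coeff (homogenize p) d) m =
     (\<Sum>m'\<in>Poly_Mapping.keys p. if m' = m then (if monom_degree m = d then Poly_Mapping.lookup p m else 0) else 0)"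
    by (simp only: coeff_sum lookup_sum) (rule sum.cong, auto simp: lookup_single when_def)
  then show ?thesis by (simp add: in_keys_iff)
qed

lemma total_degree_leI:
  assumes "\<And>m. Poly_Mapping.lookup p m \<noteq> 0 \<Longrightarrow> monom_degree m \<le> d"
  shows "total_degree p \<le> d"
  using assms by (auto simp: total_degree_def monom_degree_def in_keys_iff)

lemma monom_degree_le_total_degree:
  assumes "Poly_Mapping.lookup p m \<noteq> 0"
  shows "monom_degree m \<le> total_degree p"
  using assms by (auto simp: total_degree_def monom_degree_def in_keys_iff intro!: Max_ge)

lemma total_degree_eq_degree: "total_degree p = degree (homogenize p)"
proof (rule antisym)
  show "total_degree p \<le> degree (homogenize p)"
  proof (rule total_degree_leI)
    fix m assume "Poly_Mapping.lookup p m \<noteq> 0"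
    then have "Poly_Mapping.lookup (coeff (homogenize p) (monom_degree m)) m \<noteq> 0"
      by (simp add: lookup_coeff_homogenize)
    then have "coeff (homogenize p) (monom_degree m) \<noteq> 0"
      by (metis lookup_zero)
    then show "monom_degree m \<le> degree (homogenize p)" by (rule le_degree)
  qed
  show "degree (homogenize p) \<le> total_degree p"
  proof (rule degree_le, intro allI impI)
    fix d assume "total_degree p < d"
    then show "coeff (homogenize p) d = 0"
      using monom_degree_le_total_degree[of p]
      by (intro poly_mapping_eqI) (force simp: lookup_coeff_homogenize)
  qed
qed

lemma homogenize_eq_0_iff: "homogenize p = 0 \<longleftrightarrow> p = 0"
proof
  assume "homogenize p = 0"
  then have "Poly_Mapping.lookup p m = 0" for m
    using lookup_coeff_homogenize[of p "monom_degree m" m] by simp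
  then show "p = 0" by (intro poly_mapping_eqI) simp
qed (simp add: unital_hom.zero[OF unital_hom_homogenize])

lemma total_degree_mult:
  fixes p q :: "('n::linorder, 'k::field) mpoly"
  assumes "p \<noteq> 0" "q \<noteq> 0"
  shows "total_degree (p * q) = total_degree p + total_degree q"
  using assms
  by (simp add: total_degree_eq_degree unital_hom.mult[OF unital_hom_homogenize]
      degree_mult_eq homogenize_eq_0_iff)

lemma total_degree_mult_le:
  fixes p q :: "('n, 'k::comm_ring_1) mpoly"
  shows "total_degree (p * q) \<le> total_degree p + total_degree q"
  by (simp add: total_degree_eq_degree unital_hom.mult[OF unital_hom_homogenize] degree_mult_le)

lemma total_degree_one [simp]: "total_degree (1 :: ('n, 'k::comm_ring_1) mpoly) = 0"
  by (simp add: total_degree_eq_degree unital_hom.one[OF unital_hom_homogenize])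

lemma total_degree_prod_le:
  fixes h :: "'a \<Rightarrow> ('n, 'k::comm_ring_1) mpoly"
  assumes "finite A"
  shows "total_degree (prod h A) \<le> (\<Sum>a\<in>A. total_degree (h a))"
  using assms
  by (induction A rule: finite_induct) (auto intro: le_trans[OF total_degree_mult_le])

lemma total_degree_power_le:
  fixes p :: "('n, 'k::comm_ring_1) mpoly"
  shows "total_degree (p ^ n) \<le> n * total_degree p"
  by (induction n) (auto intro: le_trans[OF total_degree_mult_le])

lemma total_degree_eq_0D:
  assumes "total_degree p = 0"
  shows "p = mconst (Poly_Mapping.lookup p 0)"
proof (rule poly_mapping_eqI)
  fix m :: "'a \<Rightarrow>\<^sub>0 nat"
  show "Poly_Mapping.lookup p m = Poly_Mapping.lookup (mconst (Poly_Mapping.lookup p 0)) m"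
  proof (cases "m = 0")
    case False
    then obtain i where "i \<in> Poly_Mapping.keys m" by (metis keys_eq_empty ex_in_conv)
    then have "monom_degree m \<noteq> 0"
      by (auto simp: monom_degree_def in_keys_iff)
    then have "Poly_Mapping.lookup p m = 0"
      using monom_degree_le_total_degree[of p m] assms by auto
    then show ?thesis using False by (simp add: mconst_def lookup_single)
  qed (simp add: mconst_def)
qed

lemma mconst_dvd_one: "c \<noteq> 0 \<Longrightarrow> mconst (c::'k::field) dvd (1 :: ('n, 'k) mpoly)"
  by (rule dvdI[of _ _ "mconst (inverse c)"]) (simp add: mconst_def mult_single)

text \<open>Among the fractions that represent \<open>f\<close>, take one whose degrees have the least sum: a common
  divisor of positive degree could be cancelled, and the remaining ones are units.\<close>

lemma reduced_fraction_exists: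
  fixes f :: "('n::{finite,linorder}, 'k::field) ratfun"
  shows "\<exists>p q. reduced_fraction p q f"
proof -
  let ?P = "\<lambda>(p, q). q \<noteq> 0 \<and> f = Fract p q"
  let ?d = "\<lambda>(p, q :: ('n, 'k) mpoly). total_degree p + total_degree (q :: ('n, 'k) mpoly)"
  obtain p0 q0 where "?P (p0, q0)" by (cases f) auto
  then obtain z where z: "?P z" and min: "\<And>z'. ?P z' \<Longrightarrow> ?d z \<le> ?d z'"
    using exists_least_iff[of "\<lambda>n. \<exists>z. ?P z \<and> ?d z = n"] by (metis (lifting) leI)
  obtain p q where pq: "z = (p, q)" by (cases z)
  have "h dvd 1" if h: "h dvd p" "h dvd q" for h
  proof -
    obtain p' q' where p': "p = h * p'" and q': "q = h * q'" using h by (auto elim!: dvdE)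
    have nz: "h \<noteq> 0" "q' \<noteq> 0" using z pq q' by auto
    have "?P (p', q')" using z pq p' q' nz by (simp add: eq_fract ac_simps)
    then have "total_degree p + total_degree q \<le> total_degree p' + total_degree q'"
      using min pq by fastforce
    moreover have "total_degree q = total_degree h + total_degree q'"
      using nz q' by (simp add: total_degree_mult)
    moreover have "total_degree p \<ge> total_degree p'"
      using nz p' by (cases "p' = 0") (simp_all add: total_degree_mult)
    ultimately have "total_degree h = 0" by simp
    then have "h = mconst (Poly_Mapping.lookup h 0)" by (rule total_degree_eq_0D)
    then show ?thesis using nz mconst_dvd_one[of "Poly_Mapping.lookup h 0"]
      by (metis mconst_def single_zero)
  qed
  then show ?thesis using z pq by (auto simp: reduced_fraction_def)
qed

lemma rat_degree_fraction:
  fixes f :: "('n::{finite,linorder}, 'k::field) ratfun"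
  obtains p q where "q \<noteq> 0" "f = Fract p q" "rat_degree f = total_degree p + total_degree q"
proof -
  have "\<exists>d p q. reduced_fraction p q f \<and> d = total_degree p + total_degree q"
    using reduced_fraction_exists[of f] by blast
  from someI_ex[OF this] show ?thesis
    using that unfolding rat_degree_def reduced_fraction_def by blast
qed


section \<open>Extending homomorphisms to fraction fields and to polynomials\<close>

text \<open>The homomorphism on the fraction field that extends \<open>\<phi>\<close>, when \<open>\<phi>\<close> sends nonzero elements to
  units. The codomain is only a domain, and division is expressed through multiplication, because
  the case of interest is a ring of power series.\<close>

definition fract_extend :: "('a::idom \<Rightarrow> 'b::idom) \<Rightarrow> 'a fract \<Rightarrow> 'b" where
  "fract_extend \<phi> f = (THE r. \<exists>p q. q \<noteq> 0 \<and> f = Fract p q \<and> r * \<phi> q = \<phi> p)"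

context
  fixes \<phi> :: "'a::idom \<Rightarrow> 'b::idom"
  assumes hom: "unital_hom \<phi>" and units: "\<And>q. q \<noteq> 0 \<Longrightarrow> \<phi> q dvd 1"
begin

interpretation unital_hom \<phi> by (fact hom)

lemma hom_nonzero: "q \<noteq> 0 \<Longrightarrow> \<phi> q \<noteq> 0"
  using units by fastforce

lemma fract_extend_mult:
  assumes "q \<noteq> 0"
  shows "fract_extend \<phi> (Fract p q) * \<phi> q = \<phi> p"
proof -
  have "\<exists>!r. \<exists>p' q'. q' \<noteq> 0 \<and> Fract p q = Fract p' q' \<and> r * \<phi> q' = \<phi> p'"
  proof (rule ex_ex1I)
    obtain u where u: "1 = \<phi> q * u" using units[OF assms] by (rule dvdE)
    then have "\<phi> p * u * \<phi> q = \<phi> p" by (simp add: mult.assoc mult.commute[of u])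
    then show "\<exists>r p' q'. q' \<noteq> 0 \<and> Fract p q = Fract p' q' \<and> r * \<phi> q' = \<phi> p'"
      using assms by blast
  next
    fix r s
    assume "\<exists>p' q'. q' \<noteq> 0 \<and> Fract p q = Fract p' q' \<and> r * \<phi> q' = \<phi> p'"
      and "\<exists>p' q'. q' \<noteq> 0 \<and> Fract p q = Fract p' q' \<and> s * \<phi> q' = \<phi> p'"
    then obtain p1 q1 p2 q2 where 1: "q1 \<noteq> 0" "q2 \<noteq> 0" "Fract p1 q1 = Fract p2 q2"
      "r * \<phi> q1 = \<phi> p1" "s * \<phi> q2 = \<phi> p2" by metis
    then have "p1 * q2 = p2 * q1" by (simp add: eq_fract)
    then have "\<phi> (p1 * q2) = \<phi> (p2 * q1)" by simp
    then have "(r * \<phi> q1) * \<phi> q2 = (s * \<phi> q2) * \<phi> q1"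
      by (simp only: 1 mult)
    then have "r * (\<phi> q1 * \<phi> q2) = s * (\<phi> q1 * \<phi> q2)"
      by (simp only: ac_simps)
    then show "r = s" using 1 hom_nonzero by simp
  qed
  from theI'[OF this] obtain p' q' where
    1: "q' \<noteq> 0" "Fract p q = Fract p' q'" "fract_extend \<phi> (Fract p q) * \<phi> q' = \<phi> p'"
    unfolding fract_extend_def[symmetric] by blast
  then have "p * q' = p' * q" using assms by (simp add: eq_fract)
  then have "\<phi> (p * q') = \<phi> (p' * q)" by simp
  then have "\<phi> p * \<phi> q' = (fract_extend \<phi> (Fract p q) * \<phi> q') * \<phi> q"
    by (simp only: 1(3) mult)
  then have "(fract_extend \<phi> (Fract p q) * \<phi> q) * \<phi> q' = \<phi> p * \<phi> q'"
    by (simp only: ac_simps)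
  then show ?thesis using hom_nonzero[OF 1(1)] by simp
qed

lemma fract_extend_eqI:
  assumes "q \<noteq> 0" "r * \<phi> q = \<phi> p"
  shows "fract_extend \<phi> (Fract p q) = r"
  using fract_extend_mult[OF assms(1), of p] assms hom_nonzero by (metis mult_cancel_right)

lemma fract_extend_of: "fract_extend \<phi> (Fract p 1) = \<phi> p"
  by (rule fract_extend_eqI) (simp_all add: one)

lemma unital_hom_fract_extend: "unital_hom (fract_extend \<phi>)"
proof
  show "fract_extend \<phi> 1 = 1" by (simp add: One_fract_def fract_extend_of one)
  fix x y :: "'a fract"
  obtain a b where x: "x = Fract a b" "b \<noteq> 0" by (cases x) auto
  obtain c d where y: "y = Fract c d" "d \<noteq> 0" by (cases y) auto
  have *: "fract_extend \<phi> x * \<phi> b = \<phi> a" "fract_extend \<phi> y * \<phi> d = \<phi> c"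
    using x y fract_extend_mult by auto
  have "(fract_extend \<phi> x + fract_extend \<phi> y) * \<phi> (b * d)
      = (fract_extend \<phi> x * \<phi> b) * \<phi> d + (fract_extend \<phi> y * \<phi> d) * \<phi> b"
    by (simp add: mult algebra_simps)
  then have "(fract_extend \<phi> x + fract_extend \<phi> y) * \<phi> (b * d) = \<phi> (a * d + c * b)"
    by (simp add: * mult add)
  then show "fract_extend \<phi> (x + y) = fract_extend \<phi> x + fract_extend \<phi> y"
    unfolding x(1) y(1) using x(2) y(2) by (simp add: fract_extend_eqI)
  have "(fract_extend \<phi> x * fract_extend \<phi> y) * \<phi> (b * d)
      = (fract_extend \<phi> x * \<phi> b) * (fract_extend \<phi> y * \<phi> d)"
    by (simp add: mult algebra_simps)
  then have "(fract_extend \<phi> x * fract_extend \<phi> y) * \<phi> (b * d) = \<phi> (a * c)"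
    by (simp add: * mult)
  then show "fract_extend \<phi> (x * y) = fract_extend \<phi> x * fract_extend \<phi> y"
    unfolding x(1) y(1) using x(2) y(2) by (simp add: fract_extend_eqI)
qed

end

lemma map_poly_hom_mult:
  assumes "unital_hom f"
  shows "map_poly f (p * q) = map_poly f p * map_poly f q"
proof -
  interpret unital_hom f by fact
  show ?thesis by (rule poly_eqI) (simp add: coeff_map_poly zero coeff_mult sum mult)
qed

lemma map_poly_hom_prod:
  assumes "unital_hom f"
  shows "map_poly f (prod h A) = (\<Prod>a\<in>A. map_poly f (h a))"
  using unital_hom.one[OF assms] unital_hom.zero[OF assms]
  by (induction A rule: infinite_finite_induct) (simp_all add: map_poly_hom_mult[OF assms] map_poly_1')

lemma poly_map_poly_hom:
  assumes "unital_hom f"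
  shows "poly (map_poly f p) (f x) = f (poly p x)"
proof -
  interpret unital_hom f by fact
  show ?thesis by (induction p) (simp_all add: map_poly_pCons zero add mult)
qed


section \<open>Algebraic elements and power series\<close>

lemma unital_hom_fps_nth_0: "unital_hom (\<lambda>z :: 'a::comm_ring_1 fps. fps_nth z 0)"
  by unfold_locales simp_all

text \<open>A field is algebraically closed in its power series: the constant term of a root is a
  root, so the linear factor that it gives can be split off.\<close>

lemma root_in_fps_is_constant:
  fixes Q :: "'a::field poly"
  assumes "Q \<noteq> 0" "poly (map_poly fps_const Q) z = 0"
  shows "z = fps_const (fps_nth z 0)"
  using assms
proof (induction "degree Q" arbitrary: Q rule: less_induct)
  case less
  define c where "c = fps_nth z 0"
  have "map_poly (\<lambda>z. fps_nth z 0) (map_poly fps_const Q) = Q"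
    by (rule poly_eqI) (simp add: coeff_map_poly)
  then have "poly Q c = 0"
    using poly_map_poly_hom[OF unital_hom_fps_nth_0, of "map_poly fps_const Q" z] less.prems
    by (simp add: c_def)
  then obtain Q' where Q': "Q = [:- c, 1:] * Q'" by (auto simp: poly_eq_0_iff_dvd elim: dvdE)
  have nz: "Q' \<noteq> 0" using less.prems Q' by auto
  have deg: "degree Q' < degree Q"
    unfolding Q' using nz by (subst degree_mult_eq) auto
  have "poly (map_poly fps_const [:- c, 1:]) z = z - fps_const c"
    by (simp add: map_poly_pCons flip: fps_const_neg)
  then have "(z - fps_const c) * poly (map_poly fps_const Q') z = 0"
    using less.prems(2) unfolding Q' map_poly_hom_mult[OF unital_hom_fps_const] poly_mult
    by (simp only:)
  then have "z - fps_const c = 0 \<or> poly (map_poly fps_const Q') z = 0"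
    by (simp only: mult_eq_0_iff)
  with deg show ?case
    using less.hyps[of Q'] nz by (auto simp: c_def[symmetric])
qed

lemma algebraic_over_mono:
  assumes "L \<subseteq> M" "algebraic_over L a"
  shows "algebraic_over M a"
  using assms unfolding algebraic_over_def by blast

text \<open>For a deformation \<open>\<Phi>\<close> of the identity, the elements with constant image thus form a
  relatively algebraically closed subfield. This carries invariance under \<open>\<Phi>\<close> from a
  transcendence basis to everything algebraic over it.\<close>

locale fps_deformation =
  fixes \<Phi> :: "'a::field \<Rightarrow> 'a fps"
  assumes hom: "unital_hom \<Phi>" and nth_0: "fps_nth (\<Phi> a) 0 = a"
begin

sublocale unital_hom \<Phi> by (fact hom)

definition fixed :: "'a set" where
  "fixed = {a. \<Phi> a = fps_const a}"

lemma is_subfield_fixed: "is_subfield fixed"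
  unfolding is_subfield_def
proof (intro conjI ballI)
  fix x assume x: "x \<in> fixed"
  show "inverse x \<in> fixed"
  proof (cases "x = 0")
    case False
    have "\<Phi> (inverse x) * \<Phi> x = 1" using False by (simp flip: mult add: one)
    also have "\<dots> = fps_const (inverse x) * \<Phi> x" using False x by (simp add: fixed_def)
    finally show ?thesis using False x by (simp add: fixed_def)
  qed (use x in simp)
qed (simp_all add: fixed_def zero one add mult uminus)

lemma algebraic_over_fixed:
  assumes "algebraic_over fixed a"
  shows "a \<in> fixed"
proof -
  obtain Q where Q: "Q \<noteq> 0" "\<And>i. coeff Q i \<in> fixed" "poly Q a = 0"
    using assms by (auto simp: algebraic_over_def)
  have "map_poly \<Phi> Q = map_poly fps_const Q"
    using Q(2) by (intro poly_eqI) (auto simp: coeff_map_poly zero fixed_def)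
  then have "poly (map_poly fps_const Q) (\<Phi> a) = 0"
    using poly_map_poly_hom[OF hom, of Q a] Q(3) by (simp add: zero)
  then show ?thesis
    using root_in_fps_is_constant[OF Q(1), of "\<Phi> a"] nth_0[of a] by (simp add: fixed_def)
qed

lemma transcendence_basis_fixed:
  assumes "transcendence_basis \<phi> F B" "Set.range \<phi> \<subseteq> fixed" "B \<subseteq> fixed"
  shows "F \<subseteq> fixed"
proof
  fix f assume "f \<in> F"
  then have "algebraic_over (subfield_generated (Set.range \<phi> \<union> B)) f"
    using assms(1) by (simp add: transcendence_basis_def)
  moreover have "subfield_generated (Set.range \<phi> \<union> B) \<subseteq> fixed"
    unfolding subfield_generated_def using assms(2,3) is_subfield_fixed by (intro Inter_lower) simp
  ultimately have "algebraic_over fixed f" by (rule algebraic_over_mono[rotated])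
  then show "f \<in> fixed" by (rule algebraic_over_fixed)
qed

end


section \<open>Finite transcendence bases\<close>

text \<open>An indexed form of the bound on the size of an independent set, which also covers
  families with repeated members.\<close>

lemma (in vector_space) family_dependent:
  assumes "finite I" "finite T" "w ` I \<subseteq> span T" "card T < card I"
  obtains c where "\<exists>i\<in>I. c i \<noteq> 0" "(\<Sum>i\<in>I. c i *s w i) = 0"
proof (cases "inj_on w I")
  case True
  then have "dependent (w ` I)"
    using independent_span_bound[OF assms(2) _ assms(3)] assms(4) by (auto simp: card_image)
  then obtain u where "\<exists>v\<in>w ` I. u v \<noteq> 0" "(\<Sum>v\<in>w ` I. u v *s v) = 0"
    using dependent_finite[of "w ` I"] assms(1) by auto
  then show ?thesis
    using that[of "\<lambda>i. u (w i)"] True by (simp add: sum.reindex)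
next
  case False
  then obtain i j where ij: "i \<in> I" "j \<in> I" "i \<noteq> j" "w i = w j" by (auto simp: inj_on_def)
  let ?c = "\<lambda>k. if k = i then 1 else if k = j then - 1 else 0 :: 'a"
  have "(\<Sum>k\<in>I. ?c k *s w k) = (\<Sum>k\<in>{i, j}. ?c k *s w k)"
    by (rule sum.mono_neutral_right) (use ij assms(1) in auto)
  also have "\<dots> = 0" using ij by simp
  finally have "(\<Sum>k\<in>I. ?c k *s w k) = 0" .
  moreover have "\<exists>k\<in>I. ?c k \<noteq> 0" using ij by (intro bexI[of _ i]) auto
  ultimately show ?thesis using that[of ?c] by blast
qed

lemma vector_space_mpoly: "vector_space (\<lambda>(c::'k::field) (p :: ('n, 'k) mpoly). mconst c * p)"
  by unfold_locales
    (simp_all add: unital_hom.add[OF unital_hom_mconst] unital_hom.mult[OF unital_hom_mconst]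
      unital_hom.one[OF unital_hom_mconst] algebra_simps)

lemma finite_bounded_exponents:
  "finite {m :: 'n::finite \<Rightarrow>\<^sub>0 nat. \<forall>i. Poly_Mapping.lookup m i \<le> N}" (is "finite ?M")
  and card_bounded_exponents:
  "card {m :: 'n::finite \<Rightarrow>\<^sub>0 nat. \<forall>i. Poly_Mapping.lookup m i \<le> N} \<le> (N + 1) ^ card (UNIV :: 'n set)"
proof -
  let ?F = "PiE (UNIV :: 'n set) (\<lambda>_. {..N})"
  have sub: "?M \<subseteq> Abs_poly_mapping ` ?F"
  proof
    fix m assume "m \<in> ?M"
    then have "Poly_Mapping.lookup m \<in> ?F" by auto
    then show "m \<in> Abs_poly_mapping ` ?F"
      using Poly_Mapping.lookup_inverse[of m] by (metis imageI)
  qed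
  have fin: "finite ?F" by (intro finite_PiE) auto
  then show "finite ?M" using sub finite_surj by blast
  have "card ?M \<le> card ?F" using sub fin by (meson card_image_le card_mono finite_imageI le_trans)
  then show "card ?M \<le> (N + 1) ^ card (UNIV :: 'n set)" by (simp add: card_PiE)
qed

lemma lookup_le_total_degree:
  assumes "Poly_Mapping.lookup p m \<noteq> 0"
  shows "Poly_Mapping.lookup m i \<le> total_degree p"
proof (cases "i \<in> Poly_Mapping.keys m")
  case True
  then have "Poly_Mapping.lookup m i \<le> monom_degree m"
    unfolding monom_degree_def by (intro member_le_sum) auto
  then show ?thesis using monom_degree_le_total_degree[OF assms] by simp
qed (simp add: in_keys_iff)

lemma common_denominator:
  fixes S :: "'a::idom fract set"
  assumes "finite S"
  shows "\<exists>q. q \<noteq> 0 \<and> (\<forall>s\<in>S. \<exists>p. s = Fract p q)"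
  using assms
proof (induction S rule: finite_induct)
  case empty
  then show ?case by (auto intro: exI[of _ 1])
next
  case (insert s S)
  then obtain q where q: "q \<noteq> 0" "\<forall>s\<in>S. \<exists>p. s = Fract p q" by blast
  obtain a b where s: "s = Fract a b" "b \<noteq> 0" by (cases s) auto
  have "\<exists>p. t = Fract p (b * q)" if "t \<in> insert s S" for t
  proof (cases "t = s")
    case True
    then have "t = Fract (a * q) (b * q)" using s q by (simp add: eq_fract)
    then show ?thesis by blast
  next
    case False
    then have "t \<in> S" using that by simp
    then obtain p where "t = Fract p q" using bspec[OF q(2)] by blast
    then have "t = Fract (b * p) (b * q)" using s q by (simp add: eq_fract)
    then show ?thesis by blast
  qed
  then show ?case using s q by (intro exI[of _ "b * q"]) auto
qed

text \<open>With a common denominator \<open>q\<close>, the monomials in \<open>S\<close> with exponents below \<open>E\<close>, each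
  multiplied by the same power of \<open>q\<close>, become polynomials of degree at most a constant times
  \<open>E\<close>. There are \<open>E ^ card S\<close> of them, in a space whose dimension grows like \<open>E ^ card (UNIV :: 'n set)\<close>.\<close>

lemma algebraically_dependent_if_card_gt:
  fixes S :: "('n::{finite,linorder}, 'k::field) ratfun set"
  assumes "finite S" "card (UNIV :: 'n set) < card S"
  shows "\<not> algebraically_independent rconst S"
proof -
  obtain Q where Q: "Q \<noteq> 0" "\<forall>s\<in>S. \<exists>p. s = Fract p Q"
    using common_denominator[OF assms(1)] by blast
  then obtain P where P: "\<And>s. s \<in> S \<Longrightarrow> s = Fract (P s) Q" by metis
  define q where "q = Fract Q 1"
  have q: "q \<noteq> 0" using Q by (simp add: q_def Zero_fract_def eq_fract)
  have Ps: "Fract (P s) 1 = s * q" if "s \<in> S" for s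
    using Q by (subst P[OF that]) (simp add: q_def eq_fract)
  interpret to_fract: unital_hom "\<lambda>p :: ('n, 'k) mpoly. Fract p 1" by (rule unital_hom_to_fract)
  interpret V: vector_space "\<lambda>(c::'k) (p :: ('n, 'k) mpoly). mconst c * p" by (rule vector_space_mpoly)
  define D where "D = Max (insert (total_degree Q) ((\<lambda>s. total_degree (P s)) ` S))"
  have D: "total_degree Q \<le> D" "\<And>s. s \<in> S \<Longrightarrow> total_degree (P s) \<le> D"
    using assms(1) by (auto simp: D_def intro!: Max_ge)
  define n where "n = card (UNIV :: 'n set)"
  define C where "C = card S * D + 1"
  \<comment> \<open>large enough for \<open>E ^ (n + 1)\<close> to exceed \<open>(C * E) ^ n\<close>\<close>
  define E where "E = C ^ n + 1"
  define N where "N = card S * (E * D)"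
  define I where "I = PiE S (\<lambda>_. {..<E})"
  define w where "w e = (\<Prod>s\<in>S. P s ^ e s * Q ^ (E - e s))" for e
  define T where "T = (\<lambda>m. Poly_Mapping.single m (1::'k)) `
    {m :: 'n \<Rightarrow>\<^sub>0 nat. \<forall>i. Poly_Mapping.lookup m i \<le> N}"
  have finI: "finite I" and finT: "finite T"
    using assms(1) by (auto simp: I_def T_def intro!: finite_PiE finite_bounded_exponents)
  have "card T \<le> (N + 1) ^ n"
    unfolding T_def n_def using card_image_le[OF finite_bounded_exponents] card_bounded_exponents le_trans
    by blast
  also have "\<dots> \<le> (C * E) ^ n"
    by (rule power_mono) (auto simp: N_def C_def E_def algebra_simps)
  also have "\<dots> < E ^ (n + 1)"
  proof -
    have "C ^ n < E" "0 < E" by (simp_all add: E_def)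
    then have "C ^ n * E ^ n < E * E ^ n" by (intro mult_strict_right_mono) simp_all
    then show ?thesis by (simp only: power_mult_distrib power_add power_one_right mult.commute)
  qed
  also have "\<dots> \<le> E ^ card S" using assms(2) by (intro power_increasing) (auto simp: E_def n_def)
  also have "\<dots> = card I" using assms(1) by (simp add: I_def card_PiE)
  finally have card: "card T < card I" .
  have "w e \<in> V.span T" if e: "e \<in> I" for e
  proof -
    have "total_degree (w e) \<le> (\<Sum>s\<in>S. total_degree (P s ^ e s * Q ^ (E - e s)))"
      unfolding w_def by (rule total_degree_prod_le[OF assms(1)])
    also have "\<dots> \<le> (\<Sum>s\<in>S. E * D)"
    proof (rule sum_mono)
      fix s assume s: "s \<in> S"
      have "total_degree (P s ^ e s * Q ^ (E - e s)) \<le> e s * total_degree (P s) + (E - e s) * total_degree Q"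
        by (intro le_trans[OF total_degree_mult_le] add_mono total_degree_power_le)
      also have "\<dots> \<le> e s * D + (E - e s) * D"
        using D s by (intro add_mono mult_le_mono2) auto
      also have "\<dots> = E * D"
        using e s by (auto simp: I_def PiE_iff simp flip: add_mult_distrib)
      finally show "total_degree (P s ^ e s * Q ^ (E - e s)) \<le> E * D" .
    qed
    finally have deg: "total_degree (w e) \<le> N" by (simp add: N_def)
    have "(\<Sum>m\<in>Poly_Mapping.keys (w e). mconst (Poly_Mapping.lookup (w e) m) * Poly_Mapping.single m 1) \<in> V.span T"
    proof (intro V.span_sum V.span_scale V.span_base)
      fix m assume "m \<in> Poly_Mapping.keys (w e)"
      then have "\<forall>i. Poly_Mapping.lookup m i \<le> N"
        using lookup_le_total_degree[of "w e" m, THEN le_trans, OF _ deg] by (simp add: in_keys_iff)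
      then show "Poly_Mapping.single m 1 \<in> T" by (simp add: T_def)
    qed
    then show ?thesis
      using sum_of_monomials[of "w e"] by (simp add: mconst_def mult_single)
  qed
  then obtain c where c: "\<exists>e\<in>I. c e \<noteq> 0" "(\<Sum>e\<in>I. mconst (c e) * w e) = 0"
    using V.family_dependent[OF finI finT, of w] card by blast
  define exponent where "exponent e = (\<Sum>s\<in>S. Poly_Mapping.single s (e s))" for e :: "('n, 'k) ratfun \<Rightarrow> nat"
  have lookup_exponent: "Poly_Mapping.lookup (exponent e) s = (if s \<in> S then e s else 0)" for e s
    using assms(1) by (simp add: exponent_def lookup_sum lookup_single when_def sum.delta)
  have keys_exponent: "Poly_Mapping.keys (exponent e) \<subseteq> S" for e
    by (auto simp: in_keys_iff lookup_exponent split: if_splits)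
  have inj: "inj_on exponent I"
  proof (rule inj_onI)
    fix e e' assume e: "e \<in> I" "e' \<in> I" "exponent e = exponent e'"
    show "e = e'"
    proof (rule PiE_ext)
      show "e \<in> PiE S (\<lambda>_. {..<E})" "e' \<in> PiE S (\<lambda>_. {..<E})" using e by (simp_all add: I_def)
      fix s assume "s \<in> S"
      then show "e s = e' s" using lookup_exponent[of e s] lookup_exponent[of e' s] e by simp
    qed
  qed
  define R where "R = (\<Sum>e\<in>I. Poly_Mapping.single (exponent e) (c e))"
  have lookup_R: "Poly_Mapping.lookup R (exponent e) = c e" if "e \<in> I" for e
  proof -
    have "Poly_Mapping.lookup R (exponent e) = (\<Sum>e'\<in>I. if e' = e then c e else 0)"
      unfolding R_def lookup_sum using inj that
      by (intro sum.cong) (auto simp: lookup_single when_def inj_on_def)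
    then show ?thesis using finI that by simp
  qed
  have "R \<noteq> 0" using c(1) lookup_R by fastforce
  moreover have "\<forall>m\<in>Poly_Mapping.keys R. Poly_Mapping.keys m \<subseteq> S"
  proof
    fix m assume "m \<in> Poly_Mapping.keys R"
    then have "m \<in> (\<Union>e\<in>I. Poly_Mapping.keys (Poly_Mapping.single (exponent e) (c e)))"
      unfolding R_def using Poly_Mapping.keys_sum by fast
    then show "Poly_Mapping.keys m \<subseteq> S" using keys_exponent by (auto split: if_splits)
  qed
  moreover have "msubst rconst (\<lambda>a. a) R = 0"
  proof -
    have w: "Fract (w e) 1 = monom_value (\<lambda>a. a) (exponent e) * q ^ (E * card S)" if "e \<in> I" for e
    proof -
      have "Fract (w e) 1 = (\<Prod>s\<in>S. (s * q) ^ e s * q ^ (E - e s))"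
        by (simp add: w_def to_fract.prod to_fract.mult to_fract.power Ps q_def)
      also have "\<dots> = (\<Prod>s\<in>S. s ^ e s * q ^ E)"
      proof (rule prod.cong)
        fix s assume "s \<in> S"
        then have "e s \<le> E" using that by (auto simp: I_def PiE_iff intro: less_imp_le)
        then have "q ^ e s * q ^ (E - e s) = q ^ E" by (simp flip: power_add)
        then show "(s * q) ^ e s * q ^ (E - e s) = s ^ e s * q ^ E"
          by (simp add: power_mult_distrib mult.assoc)
      qed simp
      also have "\<dots> = (\<Prod>s\<in>S. s ^ e s) * q ^ (E * card S)"
        by (simp add: prod.distrib power_mult)
      also have "(\<Prod>s\<in>S. s ^ e s) = monom_value (\<lambda>a. a) (exponent e)"
        by (subst monom_value_superset[OF assms(1) keys_exponent]) (simp add: lookup_exponent)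
      finally show ?thesis .
    qed
    have "msubst rconst (\<lambda>a. a) R * q ^ (E * card S)
        = (\<Sum>e\<in>I. rconst (c e) * (monom_value (\<lambda>a. a) (exponent e) * q ^ (E * card S)))"
      by (simp add: R_def msubst_sum[OF unital_hom_rconst] msubst_single unital_hom.zero[OF unital_hom_rconst]
          sum_distrib_right mult.assoc)
    also have "\<dots> = Fract (\<Sum>e\<in>I. mconst (c e) * w e) 1"
      by (simp add: to_fract.sum to_fract.mult rconst_def w del: mult_fract)
    finally show ?thesis using c(2) q by (simp add: to_fract.zero)
  qed
  ultimately show ?thesis unfolding algebraically_independent_def by blast
qed

lemma is_subfield_generated: "is_subfield (subfield_generated S)"
  unfolding subfield_generated_def is_subfield_def by auto

lemma msubst_in_subfield:
  assumes "is_subfield L" "Set.range \<phi> \<subseteq> L" "B \<subseteq> L"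
    and "\<forall>m\<in>Poly_Mapping.keys P. Poly_Mapping.keys m \<subseteq> B"
  shows "msubst \<phi> (\<lambda>a. a) P \<in> L"
proof -
  have mult: "x * y \<in> L" and add: "x + y \<in> L" if "x \<in> L" "y \<in> L" for x y
    using assms(1) that by (auto simp: is_subfield_def)
  have one: "1 \<in> L" and zero: "0 \<in> L" using assms(1) by (auto simp: is_subfield_def)
  have power: "x ^ n \<in> L" if "x \<in> L" for x n
    by (induction n) (auto simp: one mult that)
  have prod: "prod h A \<in> L" if "\<And>a. a \<in> A \<Longrightarrow> h a \<in> L" for h and A :: "'a set"
    using that by (induction A rule: infinite_finite_induct) (auto simp: one mult)
  have sum: "sum h A \<in> L" if "\<And>a. a \<in> A \<Longrightarrow> h a \<in> L" for h and A :: "('a \<Rightarrow>\<^sub>0 nat) set"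
    using that by (induction A rule: infinite_finite_induct) (auto simp: zero add)
  show ?thesis unfolding msubst_def
    by (intro sum mult prod power) (use assms in auto)
qed

text \<open>A relation between \<open>f\<close> and \<open>B\<close> is read as a polynomial in \<open>f\<close>. Each of its coefficients
  is a polynomial expression in \<open>B\<close>, so that independence of \<open>B\<close> keeps one of them nonzero.\<close>

lemma algebraic_over_if_insert_dependent:
  fixes \<phi> :: "'k::field \<Rightarrow> 'a::field"
  assumes "unital_hom \<phi>" "algebraically_independent \<phi> B"
    "\<not> algebraically_independent \<phi> (insert f B)"
  shows "algebraic_over (subfield_generated (Set.range \<phi> \<union> B)) f"
proof -
  obtain P :: "('a, 'k) mpoly" where P: "\<And>m. m \<in> Poly_Mapping.keys P \<Longrightarrow> Poly_Mapping.keys m \<subseteq> insert f B"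
    "msubst \<phi> (\<lambda>a. a) P = 0" "P \<noteq> 0"
    using assms(3) by (auto simp: algebraically_independent_def)
  let ?e = "\<lambda>m. Poly_Mapping.lookup m f"
  define rest where "rest m = m - Poly_Mapping.single f (?e m)" for m :: "'a \<Rightarrow>\<^sub>0 nat"
  have lookup_rest: "Poly_Mapping.lookup (rest m) a = (if a = f then 0 else Poly_Mapping.lookup m a)" for m a
    by (auto simp: rest_def lookup_minus lookup_single when_def)
  have split: "m = rest m + Poly_Mapping.single f (?e m)" for m
    by (rule poly_mapping_eqI) (auto simp: lookup_add lookup_rest lookup_single when_def)
  define part where "part i = (\<Sum>m\<in>{m \<in> Poly_Mapping.keys P. ?e m = i}.
    Poly_Mapping.single (rest m) (Poly_Mapping.lookup P m))" for i
  define Q where "Q = (\<Sum>m\<in>Poly_Mapping.keys P.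
    monom (\<phi> (Poly_Mapping.lookup P m) * monom_value (\<lambda>a. a) (rest m)) (?e m))"
  have coeff_Q: "coeff Q i = msubst \<phi> (\<lambda>a. a) (part i)" for i
    unfolding Q_def part_def coeff_sum msubst_sum[OF assms(1)] coeff_monom
    by (simp add: msubst_single unital_hom.zero[OF assms(1)] sum.inter_filter)
  have keys_part: "\<forall>m\<in>Poly_Mapping.keys (part i). Poly_Mapping.keys m \<subseteq> B" for i
  proof
    fix m assume "m \<in> Poly_Mapping.keys (part i)"
    then have "m \<in> (\<Union>m\<in>{m \<in> Poly_Mapping.keys P. ?e m = i}.
        Poly_Mapping.keys (Poly_Mapping.single (rest m) (Poly_Mapping.lookup P m)))"
      unfolding part_def using Poly_Mapping.keys_sum by fast
    then obtain m' where "m' \<in> Poly_Mapping.keys P" "m = rest m'" by (auto split: if_splits)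
    moreover have "Poly_Mapping.keys (rest m') = Poly_Mapping.keys m' - {f}"
      by (simp add: set_eq_iff in_keys_iff lookup_rest)
    ultimately show "Poly_Mapping.keys m \<subseteq> B" using P(1)[of m'] by blast
  qed
  have "poly Q f = (\<Sum>m\<in>Poly_Mapping.keys P. \<phi> (Poly_Mapping.lookup P m) * monom_value (\<lambda>a. a) m)"
    unfolding Q_def poly_sum poly_monom
  proof (rule sum.cong)
    fix m
    have "monom_value (\<lambda>a. a) m = monom_value (\<lambda>a. a) (rest m) * f ^ ?e m"
      using arg_cong[OF split[of m], of "monom_value (\<lambda>a. a)"]
      by (simp only: monom_value_add monom_value_single)
    then show "\<phi> (Poly_Mapping.lookup P m) * monom_value (\<lambda>a. a) (rest m) * f ^ ?e m =
        \<phi> (Poly_Mapping.lookup P m) * monom_value (\<lambda>a. a) m"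
      by (simp only: mult.assoc)
  qed simp
  then have "poly Q f = 0" using P(2) by (simp add: msubst_alt)
  moreover have "coeff Q i \<in> subfield_generated (Set.range \<phi> \<union> B)" for i
    unfolding coeff_Q
    by (rule msubst_in_subfield[OF is_subfield_generated _ _ keys_part])
      (auto simp: subfield_generated_def)
  moreover have "Q \<noteq> 0"
  proof
    assume "Q = 0"
    then have part: "part i = 0" for i
      using coeff_Q[of i] keys_part assms(2) by (auto simp: algebraically_independent_def)
    obtain m where m: "m \<in> Poly_Mapping.keys P" using P(3) by (metis keys_eq_empty ex_in_conv)
    have "Poly_Mapping.lookup (part (?e m)) (rest m) =
        (\<Sum>m'\<in>{m' \<in> Poly_Mapping.keys P. ?e m' = ?e m}. if m' = m then Poly_Mapping.lookup P m else 0)"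
      unfolding part_def lookup_sum
    proof (rule sum.cong)
      fix m' assume "m' \<in> {m' \<in> Poly_Mapping.keys P. ?e m' = ?e m}"
      then have "rest m' = rest m \<longleftrightarrow> m' = m" using split[of m] split[of m'] 
        by (metis (mono_tags, lifting) mem_Collect_eq)
      then show "Poly_Mapping.lookup (Poly_Mapping.single (rest m') (Poly_Mapping.lookup P m')) (rest m)
          = (if m' = m then Poly_Mapping.lookup P m else 0)"
        by (simp add: lookup_single when_def)
    qed simp
    also have "\<dots> = Poly_Mapping.lookup P m" using m by simp
    finally show False using part m by (simp add: in_keys_iff)
  qed
  ultimately show ?thesis unfolding algebraic_over_def by blast
qed

lemma algebraic_over_member:
  assumes "is_subfield L" "a \<in> L"
  shows "algebraic_over L a"
  unfolding algebraic_over_def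
  by (rule exI[of _ "[:- a, 1:]"]) (use assms in \<open>auto simp: is_subfield_def coeff_pCons split: nat.split\<close>)

lemma algebraically_independent_empty:
  fixes \<phi> :: "'k::field \<Rightarrow> 'a::field"
  assumes "unital_hom \<phi>"
  shows "algebraically_independent \<phi> {}"
  unfolding algebraically_independent_def
proof (intro allI impI)
  fix P :: "('a, 'k) mpoly"
  assume "\<forall>m\<in>Poly_Mapping.keys P. Poly_Mapping.keys m \<subseteq> {}" "msubst \<phi> (\<lambda>a. a) P = 0"
  then have keys: "Poly_Mapping.keys P \<subseteq> {0}" by auto
  interpret unital_hom \<phi> by fact
  have "\<phi> (Poly_Mapping.lookup P 0) = msubst \<phi> (\<lambda>a. a) P"
    by (subst msubst_superset[of _ "{0}"]) (use keys in \<open>auto simp: zero\<close>)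
  then have 0: "\<phi> (Poly_Mapping.lookup P 0) = 0" using \<open>msubst \<phi> (\<lambda>a. a) P = 0\<close> by simp
  have "Poly_Mapping.lookup P 0 = 0"
  proof (rule ccontr)
    assume "Poly_Mapping.lookup P 0 \<noteq> 0"
    then have "\<phi> (Poly_Mapping.lookup P 0 * inverse (Poly_Mapping.lookup P 0)) = 1"
      by (simp add: one)
    then show False using 0 by (simp only: mult) simp
  qed
  then show "P = 0" using keys
    by (intro poly_mapping_eqI) (metis in_keys_iff lookup_zero singletonD subsetD)
qed

text \<open>An independent subset of the largest possible size is a transcendence basis.\<close>

lemma finite_transcendence_basis_exists:
  fixes F :: "('n::{finite,linorder}, 'k::field) ratfun set"
  shows "\<exists>B. finite B \<and> transcendence_basis rconst F B"
proof -
  let ?P = "\<lambda>B. B \<subseteq> F \<and> finite B \<and> algebraically_independent rconst B"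
  have "\<exists>B. ?P B \<and> (\<forall>B'. ?P B' \<longrightarrow> card B' \<le> card B)"
  proof (rule Lattices_Big.ex_has_greatest_nat)
    show "?P {}" by (simp add: algebraically_independent_empty[OF unital_hom_rconst])
    show "\<forall>B. ?P B \<longrightarrow> card B < card (UNIV :: 'n set) + 1"
      using algebraically_dependent_if_card_gt by (metis Suc_eq_plus1 linorder_not_le less_Suc_eq_le)
  qed
  then obtain B where B: "?P B" and max: "\<And>B'. ?P B' \<Longrightarrow> card B' \<le> card B" by blast
  let ?L = "subfield_generated (Set.range rconst \<union> B)"
  have "algebraic_over ?L f" if f: "f \<in> F" for f
  proof (cases "f \<in> B")
    case True
    then show ?thesis
      by (intro algebraic_over_member is_subfield_generated) (auto simp: subfield_generated_def)
  next
    case False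
    have "\<not> algebraically_independent rconst (insert f B)"
      using max[of "insert f B"] B f False by auto
    then show ?thesis using B algebraic_over_if_insert_dependent[OF unital_hom_rconst] by blast
  qed
  then show ?thesis using B unfolding transcendence_basis_def by blast
qed


section \<open>Polynomials of degree at most two\<close>

lemma monom_degree_split:
  assumes "m \<noteq> 0"
  obtains i m' where "m = Poly_Mapping.single i 1 + m'" "monom_degree m = Suc (monom_degree m')"
proof -
  obtain i where i: "i \<in> Poly_Mapping.keys m" using assms by (metis keys_eq_empty ex_in_conv)
  define m' where "m' = m - Poly_Mapping.single i 1"
  have lookup: "Poly_Mapping.lookup m a = (if a = i then 1 else 0) + Poly_Mapping.lookup m' a" for a
    using i by (auto simp: m'_def lookup_minus lookup_single when_def in_keys_iff)
  have keys: "Poly_Mapping.keys m' \<subseteq> Poly_Mapping.keys m"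
    using lookup by (auto simp: in_keys_iff)
  have "monom_degree m' = (\<Sum>a\<in>Poly_Mapping.keys m. Poly_Mapping.lookup m' a)"
    unfolding monom_degree_def using keys
    by (intro sum.mono_neutral_left) (auto simp: in_keys_iff)
  then have "monom_degree m = Suc (monom_degree m')"
    using i by (simp add: monom_degree_def lookup sum.distrib)
  moreover have "m = Poly_Mapping.single i 1 + m'"
    by (rule poly_mapping_eqI) (auto simp: lookup_add lookup_single lookup when_def)
  ultimately show ?thesis using that by blast
qed

lemma monom_degree_0D: "monom_degree m = 0 \<Longrightarrow> m = 0"
  by (metis monom_degree_split nat.distinct(1))

lemma monom_degree_le_1D:
  assumes "monom_degree m \<le> 1"
  shows "m = 0 \<or> (\<exists>i. m = Poly_Mapping.single i 1)"
proof (cases "m = 0")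
  case False
  then obtain i m' where m: "m = Poly_Mapping.single i 1 + m'" "monom_degree m = Suc (monom_degree m')"
    by (rule monom_degree_split)
  then have "m' = 0" using assms by (intro monom_degree_0D) simp
  then show ?thesis using m by auto
qed simp

lemma monom_degree_le_2D:
  assumes "monom_degree m \<le> 2"
  shows "m = 0 \<or> (\<exists>i. m = Poly_Mapping.single i 1)
    \<or> (\<exists>i j. m = Poly_Mapping.single i 1 + Poly_Mapping.single j 1)"
proof (cases "m = 0")
  case False
  then obtain i m' where m: "m = Poly_Mapping.single i 1 + m'" "monom_degree m = Suc (monom_degree m')"
    by (rule monom_degree_split)
  then have "monom_degree m' \<le> 1" using assms by simp
  from monom_degree_le_1D[OF this] show ?thesis using m by auto
qed simp

lemma msubst_affine:
  assumes "total_degree p \<le> 1"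
  shows "msubst \<phi> (\<lambda>i. (1 - t) * a i + t * b i) p = (1 - t) * msubst \<phi> a p + t * msubst \<phi> b p"
proof -
  have *: "monom_value (\<lambda>i. (1 - t) * a i + t * b i) m = (1 - t) * monom_value a m + t * monom_value b m"
    if "m \<in> Poly_Mapping.keys p" for m
  proof -
    have "monom_degree m \<le> 1"
      using that assms monom_degree_le_total_degree[of p m] by (simp add: in_keys_iff)
    from monom_degree_le_1D[OF this] show ?thesis
      by (elim disjE exE) (simp_all add: monom_value_single)
  qed
  show ?thesis
    unfolding msubst_alt sum_distrib_left sum.distrib[symmetric]
    by (rule sum.cong) (simp_all only: * distrib_left mult.left_commute)
qed

text \<open>The factor of \<open>s * t\<close> is the polar form, which is bilinear since the degree is at most two.
  In this form, without a division by two, the identity holds in every characteristic.\<close>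

lemma msubst_quadratic:
  assumes "total_degree p \<le> 2"
  shows "msubst \<phi> (\<lambda>i. s * a i + t * b i) p =
    msubst \<phi> (\<lambda>i. s * a i) p + msubst \<phi> (\<lambda>i. t * b i) p - msubst \<phi> (\<lambda>i. 0) p
    + s * t * (msubst \<phi> (\<lambda>i. a i + b i) p - msubst \<phi> a p - msubst \<phi> b p + msubst \<phi> (\<lambda>i. 0) p)"
proof -
  have *: "monom_value (\<lambda>i. s * a i + t * b i) m =
    monom_value (\<lambda>i. s * a i) m + monom_value (\<lambda>i. t * b i) m - monom_value (\<lambda>i. 0) m
    + s * t * (monom_value (\<lambda>i. a i + b i) m - monom_value a m - monom_value b m + monom_value (\<lambda>i. 0) m)"
    if "m \<in> Poly_Mapping.keys p" for m
  proof -
    have "monom_degree m \<le> 2"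
      using that assms monom_degree_le_total_degree[of p m] by (simp add: in_keys_iff)
    from monom_degree_le_2D[OF this] show ?thesis
      by (elim disjE exE) (simp_all add: monom_value_single monom_value_add algebra_simps)
  qed
  show ?thesis
    unfolding msubst_alt sum_distrib_left sum.distrib[symmetric] sum_subtractf[symmetric]
    by (rule sum.cong) (simp_all only: * distrib_left right_diff_distrib mult.left_commute)
qed


section \<open>Linear actions given by matrices\<close>

text \<open>The order of the factors in \<open>A_mult\<close> is reversed because \<open>A g\<close> describes how \<open>g\<close> transforms
  coordinate functions, that is, through the action of \<open>g\<inverse>\<close> on vectors.\<close>

locale matrix_action = group G
  for G :: "('g, 'm) monoid_scheme" (structure) +
  fixes A :: "'g \<Rightarrow> 'n::{finite,linorder} \<Rightarrow> 'n \<Rightarrow> 'k::field"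
  assumes A_one: "A \<one> i j = (if i = j then 1 else 0)"
    and A_mult: "g \<in> carrier G \<Longrightarrow> h \<in> carrier G \<Longrightarrow> A (g \<otimes> h) i j = (\<Sum>k\<in>UNIV. A h i k * A g k j)"
begin

definition act :: "'g \<Rightarrow> ('n, 'k) mpoly \<Rightarrow> ('n, 'k) mpoly" where
  "act g = msubst mconst (\<lambda>i. \<Sum>j\<in>UNIV. mconst (A g i j) * mvar j)"

text \<open>The action on points with coordinates in a \<open>\<^bold>k\<close>-algebra. It is a right action, and
  it is adjoint to \<open>act\<close> under evaluation.\<close>

definition move :: "('k \<Rightarrow> 'r::comm_ring_1) \<Rightarrow> 'g \<Rightarrow> ('n \<Rightarrow> 'r) \<Rightarrow> 'n \<Rightarrow> 'r" where
  "move \<phi> g v = (\<lambda>i. \<Sum>j\<in>UNIV. \<phi> (A g i j) * v j)"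

lemma unital_hom_act: "unital_hom (act g)"
  unfolding act_def by (rule unital_hom_msubst[OF unital_hom_mconst])

lemma msubst_act:
  assumes "unital_hom \<phi>"
  shows "msubst \<phi> v (act g p) = msubst \<phi> (move \<phi> g v) p"
proof -
  interpret \<phi>: unital_hom \<phi> by fact
  interpret h: unital_hom "msubst \<phi> v" by (rule unital_hom_msubst[OF assms])
  show ?thesis
    unfolding act_def move_def msubst_msubst[OF assms]
    by (simp add: h.sum h.mult msubst_mconst msubst_mvar \<phi>.zero \<phi>.one)
qed

lemma move_move:
  assumes "unital_hom \<phi>" "g \<in> carrier G" "h \<in> carrier G"
  shows "move \<phi> h (move \<phi> g v) = move \<phi> (g \<otimes> h) v"
proof
  fix i
  interpret \<phi>: unital_hom \<phi> by fact
  have "move \<phi> h (move \<phi> g v) i = (\<Sum>j\<in>UNIV. \<Sum>k\<in>UNIV. \<phi> (A h i k) * (\<phi> (A g k j) * v j))"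
    by (simp add: move_def sum_distrib_left) (rule sum.swap)
  then show "move \<phi> h (move \<phi> g v) i = move \<phi> (g \<otimes> h) v i"
    by (simp add: move_def A_mult assms \<phi>.sum \<phi>.mult sum_distrib_right mult.assoc)
qed

lemma move_one:
  assumes "unital_hom \<phi>"
  shows "move \<phi> \<one> v = v"
proof
  fix i
  interpret \<phi>: unital_hom \<phi> by fact
  have "move \<phi> \<one> v i = (\<Sum>j\<in>UNIV. if j = i then v j else 0)"
    unfolding move_def by (rule sum.cong) (auto simp: A_one \<phi>.one \<phi>.zero)
  then show "move \<phi> \<one> v i = v i" by simp
qed

lemma move_inv:
  assumes "unital_hom \<phi>" "g \<in> carrier G"
  shows "move \<phi> g (move \<phi> (inv g) v) = v" "move \<phi> (inv g) (move \<phi> g v) = v"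
  using assms by (simp_all add: move_move move_one)

lemma move_scale: "move \<phi> g (\<lambda>i. t * v i) = (\<lambda>i. t * move \<phi> g v i)"
  by (simp add: move_def sum_distrib_left mult.left_commute)

lemma move_add: "move \<phi> g (\<lambda>i. v i + w i) = (\<lambda>i. move \<phi> g v i + move \<phi> g w i)"
  by (simp add: move_def sum.distrib distrib_left)

lemma act_eq_msubst: "act g p = msubst mconst (move mconst g mvar) p"
  by (simp add: act_def move_def)

lemma act_act:
  assumes "g \<in> carrier G" "h \<in> carrier G"
  shows "act g (act h p) = act (g \<otimes> h) p"
  by (simp add: act_eq_msubst[of g] act_eq_msubst[of "g \<otimes> h"] msubst_act[OF unital_hom_mconst]
      move_move[OF unital_hom_mconst assms])

lemma act_one: "act \<one> p = p"
  by (simp add: act_eq_msubst move_one[OF unital_hom_mconst] msubst_mconst_mvar)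

lemma act_nonzero:
  assumes "g \<in> carrier G" "p \<noteq> 0"
  shows "act g p \<noteq> 0"
proof
  assume "act g p = 0"
  then have "act (inv g) (act g p) = 0" by (simp add: unital_hom.zero[OF unital_hom_act])
  then show False using assms by (simp add: act_act act_one)
qed

text \<open>Write \<open>M\<close> for \<open>move \<phi> g\<close>. An invariant polynomial of degree at most two agrees at \<open>a\<close> and
  \<open>b\<close> because its polar form is invariant and symmetric, hence takes the same value at
  \<open>(v, M v)\<close> and at \<open>(v, M\<inverse> v)\<close>. For a quotient of affine polynomials, the difference of the two
  sides is affine in each of \<open>a\<close> and \<open>b\<close>, so that it suffices to let both run through the
  endpoints of their segments. There it vanishes by invariance under \<open>g\<close> and \<open>g\<^sup>2\<close>, since those
  endpoints are \<open>M\<inverse> v\<close>, \<open>v\<close> and \<open>M v\<close>.\<close>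

lemma degree_2_invariants_agree:
  fixes \<phi> :: "'k \<Rightarrow> 'r::idom" and t v
  assumes "unital_hom \<phi>" and g: "g \<in> carrier G"
    and "q \<noteq> 0" and deg: "total_degree p + total_degree q \<le> 2"
    and inv: "\<And>h. h \<in> carrier G \<Longrightarrow> act h p * q = p * act h q"
  defines "a \<equiv> \<lambda>i. (1 - t) * v i + t * move \<phi> (inv g) v i"
    and "b \<equiv> \<lambda>i. (1 - t) * v i + t * move \<phi> g v i"
  shows "msubst \<phi> b p * msubst \<phi> a q = msubst \<phi> b q * msubst \<phi> a p"
proof -
  interpret \<phi>: unital_hom \<phi> by fact
  note hom = \<open>unital_hom \<phi>\<close>
  have quadratic: "msubst \<phi> b P = msubst \<phi> a P" if "total_degree P \<le> 2" "act g P = P" for P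
  proof -
    have M: "msubst \<phi> (move \<phi> g w) P = msubst \<phi> w P" for w
      using msubst_act[OF hom, of w g P] that by simp
    have M': "msubst \<phi> (move \<phi> (inv g) w) P = msubst \<phi> w P" for w
      using M[of "move \<phi> (inv g) w"] by (simp add: move_inv[OF hom g])
    have "msubst \<phi> (\<lambda>i. t * move \<phi> g v i) P = msubst \<phi> (\<lambda>i. t * move \<phi> (inv g) v i) P"
      by (simp add: M M' flip: move_scale)
    moreover have "msubst \<phi> (\<lambda>i. v i + move \<phi> g v i) P = msubst \<phi> (\<lambda>i. v i + move \<phi> (inv g) v i) P"
    proof -
      have "move \<phi> g (\<lambda>i. v i + move \<phi> (inv g) v i) = (\<lambda>i. v i + move \<phi> g v i)"
        by (simp add: move_add move_inv[OF hom g] add.commute)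
      then show ?thesis using M[of "\<lambda>i. v i + move \<phi> (inv g) v i"] by simp
    qed
    ultimately show ?thesis
      by (simp add: a_def b_def msubst_quadratic[OF that(1)] M M')
  qed
  have act_mconst: "act h (mconst c) = mconst c" for h c
    by (simp add: act_def msubst_mconst unital_hom.zero[OF unital_hom_mconst])
  consider (const_q) "total_degree q = 0" | (const_p) "total_degree p = 0"
    | (affine) "total_degree p \<le> 1" "total_degree q \<le> 1"
    using deg by linarith
  then show ?thesis
  proof cases
    case const_q
    then obtain c where c: "q = mconst c" using total_degree_eq_0D by blast
    then have "act g p = p" using inv[OF g] \<open>q \<noteq> 0\<close> act_mconst by simp
    then show ?thesis using quadratic[of p] deg c by (simp add: msubst_mconst \<phi>.zero mult.commute)
  next
    case const_p
    then obtain c where c: "p = mconst c" using total_degree_eq_0D by blast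
    show ?thesis
    proof (cases "p = 0")
      case False
      then have "act g q = q" using inv[OF g] c act_mconst by simp
      then show ?thesis using quadratic[of q] deg c by (simp add: msubst_mconst \<phi>.zero mult.commute)
    qed (simp add: msubst_zero)
  next
    case affine
    \<comment> \<open>the cross product that measures how far \<open>p / q\<close> is from agreeing at two points\<close>
    define X where "X v w = msubst \<phi> v p * msubst \<phi> w q - msubst \<phi> v q * msubst \<phi> w p" for v w
    have X: "X (move \<phi> h w) w = 0" if "h \<in> carrier G" for h w
    proof -
      have "msubst \<phi> w (act h p * q) = msubst \<phi> w (p * act h q)" using inv[OF that] by simp
      then show ?thesis
        by (simp add: X_def unital_hom.mult[OF unital_hom_msubst[OF hom]] msubst_act[OF hom] mult.commute)
    qed
    have ab: "msubst \<phi> a P = (1 - t) * msubst \<phi> v P + t * msubst \<phi> (move \<phi> (inv g) v) P"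
      "msubst \<phi> b P = (1 - t) * msubst \<phi> v P + t * msubst \<phi> (move \<phi> g v) P"
      if "total_degree P \<le> 1" for P
      unfolding a_def b_def by (rule msubst_affine[OF that])+
    have "X b a = (1 - t) * (1 - t) * X v v + (1 - t) * t * X v (move \<phi> (inv g) v)
        + t * (1 - t) * X (move \<phi> g v) v + t * t * X (move \<phi> g v) (move \<phi> (inv g) v)"
      unfolding X_def ab[OF affine(1)] ab[OF affine(2)] by algebra
    moreover have "X v v = 0" by (simp add: X_def)
    moreover have "X v (move \<phi> (inv g) v) = 0"
      using X[OF g, of "move \<phi> (inv g) v"] by (simp add: move_inv[OF hom g])
    moreover have "X (move \<phi> g v) (move \<phi> (inv g) v) = 0"
      using X[of "g \<otimes> g" "move \<phi> (inv g) v"] g by (simp add: move_inv[OF hom g] flip: move_move[OF hom g g])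
    ultimately show ?thesis using X[OF g, of v] by (simp add: X_def)
  qed
qed

end


section \<open>A deformation fixing the invariants of degree at most two\<close>

definition ratvar :: "'n \<Rightarrow> ('n::{finite,linorder}, 'k::field) ratfun" where
  "ratvar i = Fract (mvar i) 1"

definition fps_rconst :: "'k::field \<Rightarrow> ('n::{finite,linorder}, 'k) ratfun fps" where
  "fps_rconst c = fps_const (rconst c)"

lemma unital_hom_fps_rconst: "unital_hom fps_rconst"
  unfolding fps_rconst_def by (rule unital_hom_compose[OF unital_hom_rconst unital_hom_fps_const])

lemma msubst_ratvar: "msubst rconst ratvar p = Fract p 1"
  by (subst unital_hom_eq_msubst[OF unital_hom_to_fract]) (simp add: rconst_def[abs_def] ratvar_def[abs_def])

context matrix_action
begin

text \<open>The point \<open>source g\<close> solves \<open>(1 - t) y + t (M\<inverse> y) = x\<close> for the vector \<open>x\<close> of the variables, as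
  the geometric series in \<open>t (1 - M\<inverse>)\<close> applied to \<open>x\<close>; then \<open>target g\<close> is the image of \<open>x\<close> under
  the map \<open>((1 - t) + t M) ((1 - t) + t M\<inverse>)\<inverse>\<close>.\<close>

primrec source_coeff :: "'g \<Rightarrow> nat \<Rightarrow> 'n \<Rightarrow> ('n, 'k) ratfun" where
  "source_coeff g 0 = ratvar"
| "source_coeff g (Suc k) = (\<lambda>i. source_coeff g k i - move rconst (inv g) (source_coeff g k) i)"

definition source :: "'g \<Rightarrow> 'n \<Rightarrow> ('n, 'k) ratfun fps" where
  "source g i = Abs_fps (\<lambda>k. source_coeff g k i)"

definition target :: "'g \<Rightarrow> 'n \<Rightarrow> ('n, 'k) ratfun fps" where
  "target g i = (1 - fps_X) * source g i + fps_X * move fps_rconst g (source g) i"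

lemma nth_move_source:
  "fps_nth (move fps_rconst h (source g) i) k = move rconst h (source_coeff g k) i"
  by (simp add: move_def fps_sum_nth fps_rconst_def source_def)

lemma source_equation:
  "(1 - fps_X) * source g i + fps_X * move fps_rconst (inv g) (source g) i = fps_const (ratvar i)"
proof (rule fps_ext)
  fix k
  show "fps_nth ((1 - fps_X) * source g i + fps_X * move fps_rconst (inv g) (source g) i) k
      = fps_nth (fps_const (ratvar i)) k"
    by (cases k) (simp_all add: left_diff_distrib nth_move_source source_def)
qed

lemma target_nth_0: "fps_nth (target g i) 0 = ratvar i"
  by (simp add: target_def left_diff_distrib source_def)

lemma target_nth_1:
  "fps_nth (target g i) 1 = move rconst g ratvar i - move rconst (inv g) ratvar i"
  by (simp add: target_def left_diff_distrib nth_move_source) (simp add: source_def)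

lemma nth_0_msubst_target: "fps_nth (msubst fps_rconst (target g) p) 0 = Fract p 1"
  by (simp add: hom_msubst[OF unital_hom_fps_nth_0] target_nth_0 fps_rconst_def
      flip: msubst_ratvar)

lemma fps_const_Fract: "fps_const (Fract p 1) = msubst fps_rconst (\<lambda>i. fps_const (ratvar i)) p"
  by (simp add: hom_msubst[OF unital_hom_fps_const] fps_rconst_def[abs_def] flip: msubst_ratvar)

definition deformation :: "'g \<Rightarrow> ('n, 'k) ratfun \<Rightarrow> ('n, 'k) ratfun fps" where
  "deformation g = fract_extend (msubst fps_rconst (target g))"

lemma unital_hom_msubst_target: "unital_hom (msubst fps_rconst (target g))"
  by (rule unital_hom_msubst[OF unital_hom_fps_rconst])

text \<open>Modulo \<open>t\<close> nothing is moved, so nonzero polynomials have images with nonzero constant term.\<close>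

lemma msubst_target_unit:
  assumes "q \<noteq> 0"
  shows "msubst fps_rconst (target g) q dvd 1"
  using assms by (simp add: nth_0_msubst_target Zero_fract_def eq_fract)

lemma fps_deformation: "fps_deformation (deformation g)"
proof (rule fps_deformation.intro)
  fix f :: "('n, 'k) ratfun"
  obtain p q where f: "f = Fract p q" "q \<noteq> 0" by (cases f) auto
  have "fps_nth (deformation g f) 0 * Fract q 1 = Fract p 1"
    using arg_cong[OF fract_extend_mult[OF unital_hom_msubst_target msubst_target_unit f(2), of g p],
        of "\<lambda>z. fps_nth z 0"] f
    by (simp add: deformation_def nth_0_msubst_target)
  also have "Fract p 1 = f * Fract q 1" using f by (simp add: eq_fract)
  finally have "fps_nth (deformation g f) 0 * Fract q 1 = f * Fract q 1" .
  moreover have "Fract q 1 \<noteq> 0" using f by (simp add: Zero_fract_def eq_fract)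
  ultimately show "fps_nth (deformation g f) 0 = f" by (simp only: mult_cancel_right) simp
qed (simp add: deformation_def unital_hom_fract_extend[OF unital_hom_msubst_target msubst_target_unit])

lemma deformation_polynomial: "deformation g (Fract p 1) = msubst fps_rconst (target g) p"
  unfolding deformation_def by (rule fract_extend_of[OF unital_hom_msubst_target msubst_target_unit])

lemma rconst_fixed: "rconst c \<in> fps_deformation.fixed (deformation g)"
  unfolding fps_deformation.fixed_def[OF fps_deformation]
  using msubst_mconst[of fps_rconst, OF unital_hom.zero[OF unital_hom_fps_rconst]]
  by (simp add: rconst_def deformation_polynomial fps_rconst_def)

lemma degree_2_invariant_fixed:
  assumes "g \<in> carrier G" "q \<noteq> 0" "total_degree p + total_degree q \<le> 2"
    "\<And>h. h \<in> carrier G \<Longrightarrow> act h p * q = p * act h q"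
  shows "Fract p q \<in> fps_deformation.fixed (deformation g)"
proof -
  let ?c = "\<lambda>p. fps_const (Fract p 1)" and ?t = "msubst fps_rconst (target g)"
  have nz: "?c q \<noteq> 0" using assms(2) by (simp add: Zero_fract_def eq_fract)
  have "?t p * ?c q = ?t q * ?c p"
    using degree_2_invariants_agree[OF unital_hom_fps_rconst assms, where t = fps_X and v = "source g"]
    by (simp add: fps_const_Fract source_equation target_def[abs_def])
  moreover have "Fract p 1 = Fract p q * Fract q 1" using assms(2) by (simp add: eq_fract)
  then have "?c p = fps_const (Fract p q) * ?c q" by simp
  ultimately have "?t p * ?c q = (?t q * fps_const (Fract p q)) * ?c q" by (simp only: mult.assoc)
  then have "?t p = ?t q * fps_const (Fract p q)" using nz by (simp only: mult_cancel_right) simp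
  then have "fps_const (Fract p q) * ?t q = ?t p" by (simp only: mult.commute)
  then show ?thesis
    unfolding fps_deformation.fixed_def[OF fps_deformation]
    by (simp add: deformation_def fract_extend_eqI[OF unital_hom_msubst_target msubst_target_unit assms(2)])
qed

text \<open>The coefficient of \<open>t\<close> in \<open>target g\<close> is the infinitesimal generator \<open>M - M\<inverse>\<close> of the family.\<close>

lemma matrices_eq_if_ratvar_fixed:
  assumes "\<And>i. ratvar i \<in> fps_deformation.fixed (deformation g)"
  shows "A g i j = A (inv g) i j"
proof -
  have "target g i = fps_const (ratvar i)"
    using assms[of i] unfolding fps_deformation.fixed_def[OF fps_deformation]
    by (simp add: ratvar_def deformation_polynomial msubst_mvar
        unital_hom.zero[OF unital_hom_fps_rconst] unital_hom.one[OF unital_hom_fps_rconst])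
  then have "move rconst g ratvar i = move rconst (inv g) ratvar i"
    using target_nth_1[of g i] by simp
  moreover have "move rconst h ratvar i = Fract (\<Sum>j\<in>UNIV. mconst (A h i j) * mvar j) 1" for h
    by (simp add: move_def rconst_def ratvar_def unital_hom.sum[OF unital_hom_to_fract])
  ultimately have "(\<Sum>j\<in>UNIV. mconst (A g i j) * mvar j) = (\<Sum>j\<in>UNIV. mconst (A (inv g) i j) * mvar j)"
    by (simp add: eq_fract)
  moreover have "Poly_Mapping.lookup (\<Sum>j\<in>UNIV. mconst (A h i j) * mvar j) (Poly_Mapping.single j 1) = A h i j" for h
  proof -
    have "Poly_Mapping.lookup (mconst (A h i k) * mvar k) (Poly_Mapping.single j 1) = (if k = j then A h i k else 0)" for k
    proof -
      have "Poly_Mapping.single k (1::nat) = Poly_Mapping.single j 1 \<longleftrightarrow> k = j"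
        by (metis keys_single one_neq_zero singleton_inject)
      then show ?thesis by (simp add: mconst_def mvar_def mult_single lookup_single when_def)
    qed
    then show ?thesis by (simp add: lookup_sum)
  qed
  note coeff = this
  ultimately show ?thesis by (simp flip: coeff)
qed

end


section \<open>The matrices of a representation\<close>

locale coordinate_representation = faithful_representation G scale \<rho>
  for G :: "('g, 'm) monoid_scheme" (structure)
    and scale :: "'k::field \<Rightarrow> 'v::ab_group_add \<Rightarrow> 'v"
    and \<rho> :: "'g \<Rightarrow> 'v \<Rightarrow> 'v" +
  fixes b :: "'n::{finite,linorder} \<Rightarrow> 'v"
  assumes basis: "indexed_basis b"
begin

definition coord :: "'v \<Rightarrow> 'n \<Rightarrow> 'k" where
  "coord v i = representation (Set.range b) v (b i)"

definition action_matrix :: "'g \<Rightarrow> 'n \<Rightarrow> 'n \<Rightarrow> 'k" where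
  "action_matrix g i j = coord (\<rho> (inv g) (b j)) i"

lemma basis': "inj b" "independent (Set.range b)" "v \<in> span (Set.range b)"
  using basis by (auto simp: indexed_basis_def)

lemma coord_expansion: "(\<Sum>i\<in>UNIV. scale (coord v i) (b i)) = v"
proof -
  have "(\<Sum>w\<in>Set.range b. scale (representation (Set.range b) v w) w) = v"
    by (rule sum_representation_eq) (simp_all add: basis')
  then show ?thesis by (simp add: sum.reindex[OF basis'(1)] coord_def)
qed

lemma coord_eqI:
  assumes "\<And>i. coord v i = coord w i"
  shows "v = w"
proof -
  have "(\<Sum>i\<in>UNIV. scale (coord v i) (b i)) = (\<Sum>i\<in>UNIV. scale (coord w i) (b i))"
    by (simp only: assms)
  then show ?thesis by (simp only: coord_expansion)
qed

lemma coord_sum_scale: "coord (\<Sum>k\<in>I. scale (c k) (w k)) i = (\<Sum>k\<in>I. c k * coord (w k) i)"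
  unfolding coord_def by (simp add: representation_sum representation_scale basis')

lemma coord_basis: "coord (b j) i = (if i = j then 1 else 0)"
  using basis'(1) by (auto simp: coord_def representation_basis[OF basis'(2)] inj_eq)

lemma rho_sum_scale:
  assumes "g \<in> carrier G"
  shows "\<rho> g (\<Sum>k\<in>I. scale (c k) (w k)) = (\<Sum>k\<in>I. scale (c k) (\<rho> g (w k)))"
proof -
  interpret l: Vector_Spaces.linear scale scale "\<rho> g" by (rule linear_rho[OF assms])
  show ?thesis by (simp add: l.sum l.scale)
qed

sublocale matrix_action G action_matrix
proof
  show "action_matrix \<one> i j = (if i = j then 1 else 0)" for i j
    by (simp add: action_matrix_def rho_one coord_basis)
  fix g h i j
  assume gh: "g \<in> carrier G" "h \<in> carrier G"
  have "\<rho> (inv (g \<otimes> h)) (b j) = \<rho> (inv h) (\<Sum>k\<in>UNIV. scale (action_matrix g k j) (b k))"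
    using gh by (simp add: inv_mult_group rho_mult action_matrix_def coord_expansion)
  also have "\<dots> = (\<Sum>k\<in>UNIV. scale (action_matrix g k j) (\<rho> (inv h) (b k)))"
    using gh by (simp add: rho_sum_scale)
  finally show "action_matrix (g \<otimes> h) i j = (\<Sum>k\<in>UNIV. action_matrix h i k * action_matrix g k j)"
    unfolding action_matrix_def[of "g \<otimes> h"]
    by (simp add: coord_sum_scale action_matrix_def mult.commute)
qed

lemma poly_action_eq_act: "poly_action G scale \<rho> b g = act g"
  by (simp add: poly_action_def act_def action_matrix_def coord_def)

lemma rat_action_Fract:
  assumes "g \<in> carrier G" "q \<noteq> 0"
  shows "rat_action G scale \<rho> b g (Fract p q) = Fract (act g p) (act g q)"
  unfolding rat_action_def poly_action_eq_act
proof (rule the_equality)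
  fix r assume "\<exists>p' q'. q' \<noteq> 0 \<and> Fract p q = Fract p' q' \<and> r = Fract (act g p') (act g q')"
  then obtain p' q' where *: "q' \<noteq> 0" "Fract p q = Fract p' q'" "r = Fract (act g p') (act g q')"
    by blast
  then have "p * q' = p' * q" using assms by (simp add: eq_fract)
  then have "act g (p * q') = act g (p' * q)" by simp
  then show "r = Fract (act g p) (act g q)"
    using * assms by (simp add: eq_fract act_nonzero unital_hom.mult[OF unital_hom_act])
qed (use assms in blast)

lemma Fract_in_invariant_field_iff:
  assumes "q \<noteq> 0"
  shows "Fract p q \<in> invariant_field G scale \<rho> b \<longleftrightarrow> (\<forall>g\<in>carrier G. act g p * q = p * act g q)"
  using assms by (simp add: invariant_field_def rat_action_Fract eq_fract act_nonzero)

lemma degree_2_invariants_fixed: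
  assumes "g \<in> carrier G" "f \<in> invariant_field G scale \<rho> b" "rat_degree f \<le> 2"
  shows "f \<in> fps_deformation.fixed (deformation g)"
proof -
  obtain p q where pq: "q \<noteq> 0" "f = Fract p q" "rat_degree f = total_degree p + total_degree q"
    by (rule rat_degree_fraction)
  then show ?thesis
    using assms Fract_in_invariant_field_iff[OF pq(1), of p] degree_2_invariant_fixed[OF assms(1) pq(1), of p]
    by simp
qed

text \<open>A variable is a root of the monic polynomial whose roots are its conjugates, and the
  coefficients of that polynomial are invariant because \<open>G\<close> permutes the conjugates.\<close>

lemma ratvar_algebraic_over_invariants:
  assumes "finite (carrier G)"
  shows "algebraic_over (invariant_field G scale \<rho> b) (ratvar i)"
proof -
  define F where "F = (\<Prod>h\<in>carrier G. [:- act h (mvar i), 1:])"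
  define Q where "Q = map_poly (\<lambda>p. Fract p 1) F"
  have act_coeff: "act g (coeff F k) = coeff F k" if g: "g \<in> carrier G" for g k
  proof -
    have "map_poly (act g) [:- act h (mvar i), 1:] = [:- act (g \<otimes> h) (mvar i), 1:]" if "h \<in> carrier G" for h
      using g that
      by (simp add: map_poly_pCons unital_hom.zero[OF unital_hom_act] unital_hom.one[OF unital_hom_act]
          unital_hom.uminus[OF unital_hom_act] act_act)
    then have "map_poly (act g) F = (\<Prod>h\<in>carrier G. [:- act (g \<otimes> h) (mvar i), 1:])"
      unfolding F_def map_poly_hom_prod[OF unital_hom_act] by (intro prod.cong) simp_all
    also have "\<dots> = F"
      unfolding F_def
      by (rule prod.reindex_bij_witness[of _ "\<lambda>h. inv g \<otimes> h" "\<lambda>h. g \<otimes> h"])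
        (use g in \<open>simp_all flip: m_assoc\<close>)
    finally have "coeff (map_poly (act g) F) k = coeff F k" by simp
    then show ?thesis by (simp add: coeff_map_poly unital_hom.zero[OF unital_hom_act])
  qed
  have coeff_Q: "coeff Q k = Fract (coeff F k) 1" for k
    by (simp add: Q_def coeff_map_poly Zero_fract_def)
  have "coeff Q k \<in> invariant_field G scale \<rho> b" for k
    unfolding coeff_Q
    by (subst Fract_in_invariant_field_iff) (simp_all add: act_coeff unital_hom.one[OF unital_hom_act])
  moreover have "poly Q (ratvar i) = 0"
  proof -
    have "poly F (mvar i) = (\<Prod>h\<in>carrier G. mvar i - act h (mvar i))"
      by (simp add: F_def poly_prod)
    also have "\<dots> = 0"
      using assms by (intro prod_zero) (auto intro: bexI[of _ \<one>] simp: act_one)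
    finally show ?thesis
      unfolding Q_def ratvar_def poly_map_poly_hom[OF unital_hom_to_fract] by (simp add: Zero_fract_def)
  qed
  moreover have "Q \<noteq> 0"
  proof -
    have "F \<noteq> 0" using assms by (simp add: F_def)
    then have "coeff Q (degree F) \<noteq> 0" by (simp add: coeff_Q Zero_fract_def eq_fract)
    then show ?thesis by auto
  qed
  ultimately show ?thesis unfolding algebraic_over_def by blast
qed

text \<open>A transcendence basis of degree at most two would be fixed by the deformation, and with it
  everything algebraic over it: the invariants and then the variables. So the deformation would
  be trivial, also to first order in \<open>t\<close>.\<close>

lemma square_eq_one_if_degree_2_basis:
  assumes "finite (carrier G)" and g: "g \<in> carrier G"
    and B: "B \<subseteq> {f \<in> invariant_field G scale \<rho> b. rat_degree f \<le> 2}"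
    and "transcendence_basis rconst (invariant_field G scale \<rho> b) B"
  shows "g \<otimes> g = \<one>"
proof -
  interpret fps_deformation "deformation g" by (rule fps_deformation)
  have "B \<subseteq> fixed"
  proof
    fix f assume "f \<in> B"
    then have "f \<in> {f \<in> invariant_field G scale \<rho> b. rat_degree f \<le> 2}" using B by (rule rev_subsetD)
    then show "f \<in> fixed" by (intro degree_2_invariants_fixed[OF g]) simp_all
  qed
  moreover have "Set.range rconst \<subseteq> fixed" by (simp add: image_subset_iff rconst_fixed)
  ultimately have "invariant_field G scale \<rho> b \<subseteq> fixed"
    by (intro transcendence_basis_fixed[OF assms(4)])
  then have "ratvar i \<in> fixed" for i
    using ratvar_algebraic_over_invariants[OF assms(1)]
    by (rule algebraic_over_fixed[OF algebraic_over_mono])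
  then have "action_matrix g i j = action_matrix (inv g) i j" for i j
    by (rule matrices_eq_if_ratvar_fixed)
  then have "coord (\<rho> (inv g) (b j)) i = coord (\<rho> g (b j)) i" for i j
    using g by (simp add: action_matrix_def)
  then have on_basis: "\<rho> (inv g) (b j) = \<rho> g (b j)" for j
    by (rule coord_eqI)
  have "\<rho> (inv g) v = \<rho> g v" for v
  proof -
    have expand: "\<rho> h v = (\<Sum>j\<in>UNIV. scale (coord v j) (\<rho> h (b j)))" if "h \<in> carrier G" for h
      using rho_sum_scale[OF that, of "coord v" b UNIV] by (simp only: coord_expansion)
    show ?thesis using g by (simp only: expand inv_closed on_basis)
  qed
  then have "\<rho> (inv g) = \<rho> g" by (rule ext)
  then have "inv g = g" using g by (intro inj_onD[OF faithful]) simp_all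
  then show ?thesis using r_inv[OF g] by simp
qed

end


section \<open>The degree bound\<close>

theorem corollary4p4:
  fixes G :: "('g, 'm) monoid_scheme"
    and scale :: "'k::field \<Rightarrow> 'v::ab_group_add \<Rightarrow> 'v"
    and \<rho> :: "'g \<Rightarrow> 'v \<Rightarrow> 'v"
    and b :: "'n::{finite,linorder} \<Rightarrow> 'v"
  assumes "comm_group G" and "finite (carrier G)"
    and "\<not> elementary_abelian 2 G"
    and "\<not> CHAR('k) dvd Coset.order G"
    and "faithful_representation G scale \<rho>"
    and "vector_space.indexed_basis scale b"
  shows "gamma_r_field G scale \<rho> b \<ge> 3"
proof -
  interpret coordinate_representation G scale \<rho> b
    by (rule coordinate_representation.intro[OF assms(5)], unfold_locales) (rule assms(6))
  let ?K = "invariant_field G scale \<rho> b"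
  let ?P = "\<lambda>d. d > 0 \<and> (\<exists>B. B \<subseteq> {f \<in> ?K. rat_degree f \<le> d} \<and> transcendence_basis rconst ?K B)"
  obtain g where g: "g \<in> carrier G" "g \<otimes>\<^bsub>G\<^esub> g \<noteq> \<one>\<^bsub>G\<^esub>"
    using assms(1,3) by (auto simp: elementary_abelian_def numeral_2_eq_2)
  obtain B where B: "finite B" "transcendence_basis rconst ?K B"
    using finite_transcendence_basis_exists by blast
  \<comment> \<open>a minimum exists: the degrees in a finite transcendence basis are bounded\<close>
  have "?P (Suc (\<Sum>f\<in>B. rat_degree f))"
  proof (intro conjI exI[of _ B] B(2) subsetI)
    fix f assume "f \<in> B"
    then show "f \<in> {f \<in> ?K. rat_degree f \<le> Suc (\<Sum>f\<in>B. rat_degree f)}"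
      using B member_le_sum[of f B rat_degree] by (auto simp: transcendence_basis_def)
  qed simp
  then have "?P (gamma_r_field G scale \<rho> b)"
    unfolding gamma_r_field_def by (rule LeastI)
  then obtain B' where B': "B' \<subseteq> {f \<in> ?K. rat_degree f \<le> gamma_r_field G scale \<rho> b}"
    "transcendence_basis rconst ?K B'" by (elim conjE exE)
  show ?thesis
  proof (rule ccontr)
    assume "\<not> gamma_r_field G scale \<rho> b \<ge> 3"
    then have "B' \<subseteq> {f \<in> ?K. rat_degree f \<le> 2}" using B'(1) by auto
    then show False using square_eq_one_if_degree_2_basis[OF assms(2) g(1) _ B'(2)] g(2) by simp
  qed
qed

end
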